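(* Let $u\in\mathbb{P}^{(m)'}$ be a zero class functional with Pearson-type equation $D(u\alpha I)=u\Psi$, where $\alpha(x)=\alpha_0+\alpha_1x+\alpha_2x^2\in\mathbb{P}_2\setminus\{0\}$ and $\Psi(x)=\psi_0+\psi_1x\in\mathbb{P}_1^{(m)}$. Put $M_n=\psi_1+n\alpha_2I$ and $V_n=M_nM_{n+1}\cdots M_{2n+1}$. Then, the differential equation $$\alpha y''+\Psi y'-nM_{n-1}y=0$$ has a unique (up to right matrix factors) matrix polynomial solution $y\in\mathbb{P}^{(m)}$. This solution is the only $n$-th matrix orthogonal polynomial $Q_n$ with respect to $u$ which has leading coefficient $\kappa_n=(E_nV_{n-1})^{-1}$, where $E_n=\langle x^nP_n,u\rangle$ and $P_n$ is the $n$-th monic matrix orthogonal polynomial with respect to $u$.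
   Context: Fix $m\ge 1$. $\mathbb{C}^{(m,m)}$ is the set of $m\times m$ complex matrices and $I$ the identity matrix. $\mathbb{P}^{(m)}$ is the left $\mathbb{C}^{(m,m)}$-module of polynomials in $x$ with coefficients in $\mathbb{C}^{(m,m)}$, $\mathbb{P}^{(m)}_n$ the subset of those of degree at most $n$, and $\mathbb{P}_n$ the scalar complex polynomials of degree at most $n$. $\mathbb{P}^{(m)'}$ is the set of left-$\mathbb{C}^{(m,m)}$-linear maps $u:\mathbb{P}^{(m)}\to\mathbb{C}^{(m,m)}$, and $\langle P,u\rangle=u(P)$. For $Q(x)=\sum_k q_kx^k\in\mathbb{P}^{(m)}$, the functional $uQ$ is defined by $\langle P,uQ\rangle=\sum_k\langle x^kP,u\rangle q_k$. The derivative $Du$ is defined by $\langle P,Du\rangle=-\langle P',u\rangle$. The moments of $u$ are $\mu_n=\langle x^nI,u\rangle$, $\Delta_n=(\mu_{i+j})_{i,j=0}^n$ is the block Hankel matrix, and $u$ is quasi-definite if $\det\Delta_n\ne0$ for all $n\ge0$. This is equivalent to the existence of a sequence of (left) matrix orthogonal polynomials with respect to $u$, i.e. $(Q_n)_{n\ge0}$ with $Q_n\in\mathbb{P}^{(m)}$, $\deg Q_n=n$, non-singular leading coefficient, $\langle x^kQ_n,u\rangle=0$ for $0\le k<n$, and $\langle x^nQ_n,u\rangle$ non-singular; it is unique up to non-singular left matrix factors. $u$ is a zero class functional if it is quasi-definite and satisfies $D(u\alpha I)=u\Psi$ for some $\alpha\in\mathbb{P}_2\setminus\{0\}$, $\Psi\in\mathbb{P}^{(m)}_1$.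 For such $u$ it is known that $M_n$ is non-singular for all $n\ge0$. *)

theory Defs
  imports Jordan_Normal_Form.Determinant "HOL-Analysis.Analysis"
begin

hide_const (open) Matrix.mat Matrix.vec Matrix.row Matrix.rows Determinant.det
no_notation Matrix.vec_index (infixl \<open>$\<close> 100)

text \<open>
  Square complex matrices of a fixed size are elements of \<^typ>\<open>complex^'m^'m\<close>, with matrix product
  \<open>**\<close> and scalar matrices \<open>mat c\<close>. Matrix polynomials are elements of
  \<^typ>\<open>(complex^'m^'m) poly\<close>. The library product on \<open>'a poly\<close> needs a commutative coefficient ring
  (and \<open>*\<close> on \<^typ>\<open>complex^'m^'m\<close> is the entrywise product), so the product and the derivative
  of matrix polynomials are defined here.
\<close>

type_synonym 'm cmat = "complex^'m^'m"
type_synonym 'm mpoly = "'m cmat poly"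
type_synonym 'm mfunctional = "'m mpoly \<Rightarrow> 'm cmat"

definition mp_times :: "'m::finite mpoly \<Rightarrow> 'm mpoly \<Rightarrow> 'm mpoly" (infixl \<open>\<star>\<close> 70) where
  "P \<star> Q = (\<Sum>i\<le>degree P. \<Sum>j\<le>degree Q. monom (coeff P i ** coeff Q j) (i + j))"

definition mp_deriv :: "'m::finite mpoly \<Rightarrow> 'm mpoly" where
  "mp_deriv P = (\<Sum>k<degree P. monom (real (Suc k) *\<^sub>R coeff P (Suc k)) k)"

definition scalar_mp :: "complex poly \<Rightarrow> 'm::finite mpoly" where
  "scalar_mp \<alpha> = map_poly mat \<alpha>"

abbreviation const_mp :: "'m::finite cmat \<Rightarrow> 'm mpoly" where
  "const_mp A \<equiv> monom A 0"

abbreviation X_mp :: "nat \<Rightarrow> 'm::finite mpoly" where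
  "X_mp k \<equiv> monom (mat 1) k"

definition left_linear :: "'m::finite mfunctional \<Rightarrow> bool" where
  "left_linear u \<longleftrightarrow>
     (\<forall>P Q. u (P + Q) = u P + u Q) \<and> (\<forall>A P. u (const_mp A \<star> P) = A ** u P)"

definition fun_times :: "'m::finite mfunctional \<Rightarrow> 'm mpoly \<Rightarrow> 'm mfunctional" where
  "fun_times u Q = (\<lambda>P. \<Sum>k\<le>degree Q. u (X_mp k \<star> P) ** coeff Q k)"

definition fun_deriv :: "'m::finite mfunctional \<Rightarrow> 'm mfunctional" where
  "fun_deriv u = (\<lambda>P. - u (mp_deriv P))"

definition moment :: "'m::finite mfunctional \<Rightarrow> nat \<Rightarrow> 'm cmat" where
  "moment u n = u (X_mp n)"

text \<open>
  The size of the block Hankel matrix varies with \<open>n\<close>, so it is a matrix in the sense of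
  \<^theory>\<open>Jordan_Normal_Form.Matrix\<close>. With \<open>m = CARD('m)\<close>, position \<open>r < (n + 1) m\<close> is entry
  \<open>r mod m\<close> of block \<open>r div m\<close>, and \<open>from_nat_into UNIV\<close> is a bijection from \<open>{..<m}\<close> to the
  index type \<open>'m\<close>; the same bijection is used for rows and columns, hence the determinant
  does not depend on it.
\<close>

definition block_hankel :: "'m::finite mfunctional \<Rightarrow> nat \<Rightarrow> complex mat" where
  "block_hankel u n =
     (let m = CARD('m); e = (from_nat_into UNIV :: nat \<Rightarrow> 'm) in
      Matrix.mat ((n + 1) * m) ((n + 1) * m)
        (\<lambda>(r, c). moment u (r div m + c div m) $ e (r mod m) $ e (c mod m)))"

definition quasi_definite :: "'m::finite mfunctional \<Rightarrow> bool" where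
  "quasi_definite u \<longleftrightarrow> (\<forall>n. Determinant.det (block_hankel u n) \<noteq> 0)"

definition pearson :: "'m::finite mfunctional \<Rightarrow> complex poly \<Rightarrow> 'm mpoly \<Rightarrow> bool" where
  "pearson u \<alpha> \<Psi> \<longleftrightarrow> \<alpha> \<noteq> 0 \<and> degree \<alpha> \<le> 2 \<and> degree \<Psi> \<le> 1 \<and>
     fun_deriv (fun_times u (scalar_mp \<alpha>)) = fun_times u \<Psi>"

definition zero_class_functional :: "'m::finite mfunctional \<Rightarrow> bool" where
  "zero_class_functional u \<longleftrightarrow> left_linear u \<and> quasi_definite u \<and> (\<exists>\<alpha> \<Psi>. pearson u \<alpha> \<Psi>)"

definition orth_poly :: "'m::finite mfunctional \<Rightarrow> nat \<Rightarrow> 'm mpoly \<Rightarrow> bool" where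
  "orth_poly u n Q \<longleftrightarrow> degree Q = n \<and> invertible (lead_coeff Q) \<and>
     (\<forall>k<n. u (X_mp k \<star> Q) = 0) \<and> invertible (u (X_mp n \<star> Q))"

definition monic_orth_poly :: "'m::finite mfunctional \<Rightarrow> nat \<Rightarrow> 'm mpoly" where
  "monic_orth_poly u n = (THE P. orth_poly u n P \<and> lead_coeff P = mat 1)"

definition E_mat :: "'m::finite mfunctional \<Rightarrow> nat \<Rightarrow> 'm cmat" where
  "E_mat u n = u (X_mp n \<star> monic_orth_poly u n)"

text \<open>
  The index of \<open>M\<close> and \<open>V\<close> is an integer, because \<open>M\<^bsub>n-1\<^esub>\<close> and \<open>V\<^bsub>n-1\<^esub>\<close> occur also for \<open>n = 0\<close>.
  In particular \<open>V\<^bsub>-1\<^esub> = M\<^bsub>-1\<^esub>\<close>. Unlike \<open>M\<^bsub>k\<^esub>\<close> with \<open>k \<ge> 0\<close>, this matrix may be singular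
  (for instance \<open>m = 1\<close>, \<open>\<alpha> = 1 - x\<^sup>2\<close>, \<open>\<Psi> = -x\<close>, the Chebyshev functional of the first kind), in which
  case \<open>\<kappa>\<^bsub>0\<^esub>\<close> does not exist.
\<close>

definition M_mat :: "complex poly \<Rightarrow> 'm::finite mpoly \<Rightarrow> int \<Rightarrow> 'm cmat" where
  "M_mat \<alpha> \<Psi> k = coeff \<Psi> 1 + mat (of_int k * coeff \<alpha> 2)"

definition V_mat :: "complex poly \<Rightarrow> 'm::finite mpoly \<Rightarrow> int \<Rightarrow> 'm cmat" where
  "V_mat \<alpha> \<Psi> k = foldr (\<lambda>i A. M_mat \<alpha> \<Psi> i ** A) [k..2 * k + 1] (mat 1)"

definition kappa :: "'m::finite mfunctional \<Rightarrow> complex poly \<Rightarrow> 'm mpoly \<Rightarrow> nat \<Rightarrow> 'm cmat" where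
  "kappa u \<alpha> \<Psi> n = matrix_inv (E_mat u n ** V_mat \<alpha> \<Psi> (int n - 1))"

definition ode_solution ::
    "complex poly \<Rightarrow> 'm::finite mpoly \<Rightarrow> nat \<Rightarrow> 'm mpoly \<Rightarrow> bool" where
  "ode_solution \<alpha> \<Psi> n y \<longleftrightarrow>
     scalar_mp \<alpha> \<star> mp_deriv (mp_deriv y) + \<Psi> \<star> mp_deriv y
       - const_mp (real n *\<^sub>R M_mat \<alpha> \<Psi> (int n - 1)) \<star> y = 0"

text \<open>The right factor \<open>C\<close> may be singular: \<open>C = 0\<close> gives the zero solution.\<close>

definition unique_up_to_right_factors :: "('m::finite mpoly \<Rightarrow> bool) \<Rightarrow> 'm mpoly \<Rightarrow> bool" where
  "unique_up_to_right_factors S y \<longleftrightarrow> y \<noteq> 0 \<and> (\<forall>z. S z \<longleftrightarrow> (\<exists>C. z = y \<star> const_mp C))"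

end

theory Submission
  imports Defs
begin

text \<open>
  The functional \<open>v = u\<alpha>\<close> satisfies the Pearson equation with \<open>\<Psi> + \<alpha>'\<close> in place of \<open>\<Psi>\<close>, which shifts
  \<open>M\<^sub>k\<close> to \<open>M\<^bsub>k+2\<^esub>\<close>, and derivatives of polynomials orthogonal for \<open>u\<close> are orthogonal for \<open>v\<close>.
  The leading coefficient of \<open>Q\<^sub>n\<close> is \<open>\<kappa>\<^sub>n\<close> exactly when \<open>\<langle>x\<^sup>nQ\<^sub>n, u\<rangle> V\<^bsub>n-1\<^esub> = I\<close>, and this condition passes,
  up to sign, from \<open>(u, Q\<^sub>n)\<close> to \<open>(v, Q\<^sub>n')\<close>. By induction on \<open>n\<close> the derivative of
  \<open>R = \<alpha>Q\<^sub>n'' + \<Psi>Q\<^sub>n' - nM\<^bsub>n-1\<^esub>Q\<^sub>n\<close> vanishes, so \<open>R\<close> is constant; for \<open>n \<ge> 2\<close> one computes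
  \<open>\<langle>R, v\<rangle> = 0\<close>, whence \<open>R = 0\<close> because \<open>\<langle>I, v\<rangle>\<close> is non-singular. The case \<open>n = 1\<close> is a direct
  calculation.

  Solutions are unique because the coefficient of \<open>x\<^sup>d\<close> in the equation for a solution of degree \<open>d\<close> is
  \<open>(d - n) M\<^bsub>d+n-1\<^esub>\<close> times its leading coefficient.
  The \<open>M\<^sub>k\<close> are non-singular: if \<open>M\<^sub>k\<close> with minimal \<open>k\<close> were singular, then there would be a non-constant \<open>y\<close>
  such that \<open>\<alpha>y'' + \<Psi>y'\<close> is constant. But \<open>D(u\<alpha>y') = u(\<alpha>y'' + \<Psi>y')\<close>, so evaluation at \<open>I\<close> shows that
  this constant is \<open>0\<close>, then \<open>u\<alpha>y' = 0\<close> and finally \<open>y' = 0\<close>.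
\<close>

section \<open>Matrices and matrix polynomials\<close>

lemma mat_mult_commute: "mat c ** A = A ** mat (c::complex)" for A :: "'m::finite cmat"
  by (simp add: matrix_matrix_mult_def mat_def vec_eq_iff if_distrib [where f="\<lambda>x. x * _"]
      if_distrib [where f="\<lambda>x. _ * x"] cong: if_cong)

lemma mat_mult_nth: "(mat c ** A) $ i $ j = c * A $ i $ j" for A :: "'m::finite cmat"
  by (simp add: matrix_matrix_mult_def mat_def vec_eq_iff if_distrib [where f="\<lambda>x. x * _"]
      cong: if_cong)

lemma mat_left_commute: "A ** (mat c ** B) = mat c ** (A ** B)" for A :: "'m::finite cmat"
  by (metis mat_mult_commute matrix_mul_assoc)

lemma mat_add: "mat (a + b) = mat a + (mat b :: 'm::finite cmat)"
  by (simp add: mat_def vec_eq_iff)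

lemma mat_mult: "mat (a * b) = mat a ** (mat b :: 'm::finite cmat)"
  by (simp add: mat_mult_nth vec_eq_iff) (simp add: mat_def)

lemma scaleR_eq_mat_mult: "r *\<^sub>R A = mat (of_real r) ** (A :: 'm::finite cmat)"
  unfolding vec_eq_iff by (simp only: mat_mult_nth vector_scaleR_component) (simp add: scaleR_conv_of_real)

lemma matrix_zero_mult [simp]: "0 ** A = 0" "A ** 0 = 0" for A :: "'m::finite cmat"
  by (simp_all add: matrix_matrix_mult_def vec_eq_iff)

lemma matrix_minus_mult [simp]: "(- A) ** B = - (A ** B)" "A ** (- B) = - (A ** B)"
  for A :: "'m::finite cmat"
  by (simp_all add: matrix_matrix_mult_def vec_eq_iff sum_negf)

lemma matrix_diff_distrib: "(A - B) ** C = A ** C - B ** C" "A ** (B - C) = A ** B - A ** C"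
  for A :: "'m::finite cmat"
  by (simp_all add: matrix_matrix_mult_def vec_eq_iff sum_subtractf algebra_simps)

lemma matrix_add_rdistrib: "(A + B) ** C = A ** C + B ** C" for A :: "complex^'n^'m::finite"
  by (simp add: matrix_matrix_mult_def vec_eq_iff sum.distrib algebra_simps)

lemma matrix_sum_mult: "sum f S ** A = (\<Sum>i\<in>S. f i ** A)" for f :: "_ \<Rightarrow> 'm::finite cmat"
  by (induction S rule: infinite_finite_induct) (simp_all add: matrix_add_rdistrib)

lemma matrix_mult_sum: "A ** sum f S = (\<Sum>i\<in>S. A ** f i)" for f :: "_ \<Rightarrow> 'm::finite cmat"
  by (induction S rule: infinite_finite_induct) (simp_all add: matrix_add_ldistrib)

lemma matrix_scaleR_mult: "(r *\<^sub>R A) ** B = r *\<^sub>R (A ** B)" "A ** (r *\<^sub>R B) = r *\<^sub>R (A ** B)"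
  for A :: "'m::finite cmat"
  by (simp_all add: matrix_matrix_mult_def vec_eq_iff scaleR_right.sum)

lemmas matrix_ring_simps = matrix_mul_assoc [symmetric] matrix_add_ldistrib matrix_add_rdistrib
  matrix_diff_distrib matrix_scaleR_mult

lemma invertible_mult_eq_0:
  fixes A B :: "'m::finite cmat"
  assumes "invertible B" "B ** A = 0"
  shows "A = 0"
proof -
  obtain C where "C ** B = mat 1"
    using assms(1) by (auto simp: invertible_def)
  then have "A = C ** (B ** A)"
    by (simp add: matrix_mul_assoc)
  with assms(2) show ?thesis by simp
qed

lemma mult_invertible_eq_0:
  fixes A B :: "'m::finite cmat"
  assumes "invertible B" "A ** B = 0"
  shows "A = 0"
proof -
  obtain C where "B ** C = mat 1"
    using assms(1) by (auto simp: invertible_def)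
  then have "A = A ** B ** C"
    by (simp add: matrix_mul_assoc [symmetric])
  with assms(2) show ?thesis by simp
qed

lemma invertible_mat: "c \<noteq> 0 \<Longrightarrow> invertible (mat (c::complex) :: 'm::finite cmat)"
  unfolding invertible_def by (rule exI [of _ "mat (1 / c)"]) (simp flip: mat_mult)

lemma invertible_imp_nonzero: "invertible A \<Longrightarrow> A \<noteq> 0" for A :: "'m::finite cmat"
proof
  assume "invertible A" "A = 0"
  then have "mat 1 = (0 :: 'm cmat)"
    by (auto simp: invertible_def)
  then show False
    by (simp add: vec_eq_iff mat_def split: if_splits)
qed

lemma matrix_inv_mult:
  assumes "invertible A"
  shows "A ** matrix_inv A = mat 1" "matrix_inv A ** A = mat 1"
  using someI_ex [OF assms [unfolded invertible_def]] by (simp_all add: matrix_inv_def)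

text \<open>A kernel vector of \<open>A\<close>, repeated in every column, gives \<open>C\<close>. A
  square matrix is wanted because \<open>C\<close> later serves as a coefficient of a matrix
  polynomial.\<close>

lemma not_invertible_imp_right_annihilator:
  fixes A :: "'m::finite cmat"
  assumes "\<not> invertible A"
  obtains C :: "'m cmat" where "C \<noteq> 0" "A ** C = 0"
proof -
  obtain x where x: "A *v x = 0" "x \<noteq> 0"
    using assms unfolding invertible_left_inverse matrix_left_invertible_ker by blast
  define C :: "'m cmat" where "C = (\<chi> i j. x $ i)"
  have "C \<noteq> 0"
    using x(2) by (auto simp: C_def vec_eq_iff)
  moreover have "A ** C = 0"
    using x(1) by (simp add: C_def vec_eq_iff matrix_matrix_mult_def matrix_vector_mult_def)
  ultimately show thesis by (rule that)
qed

section \<open>Product of matrix polynomials\<close>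

lemma coeff_star: "coeff (P \<star> Q) k = (\<Sum>i\<le>k. coeff P i ** coeff Q (k - i))"
proof -
  have *: "(\<Sum>j\<le>degree Q. coeff (monom (coeff P i ** coeff Q j) (i + j)) k)
      = (if i \<le> k then coeff P i ** coeff Q (k - i) else 0)" for i
  proof (cases "i \<le> k")
    case True
    have "(\<Sum>j\<le>degree Q. coeff (monom (coeff P i ** coeff Q j) (i + j)) k)
        = (\<Sum>j\<le>degree Q. if j = k - i then coeff P i ** coeff Q j else 0)"
      using True by (intro sum.cong) auto
    also have "\<dots> = coeff P i ** coeff Q (k - i)"
      by (simp add: coeff_eq_0)
    finally show ?thesis using True by simp
  qed (auto intro!: sum.neutral)
  have "coeff (P \<star> Q) k = (\<Sum>i\<le>degree P. if i \<le> k then coeff P i ** coeff Q (k - i) else 0)"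
    unfolding mp_times_def coeff_sum by (simp only: *)
  also have "\<dots> = (\<Sum>i\<in>{..degree P} \<inter> {..k}. coeff P i ** coeff Q (k - i))"
    by (simp add: sum.inter_restrict del: Int_atMost)
  also have "\<dots> = (\<Sum>i\<le>k. coeff P i ** coeff Q (k - i))"
    by (rule sum.mono_neutral_left) (auto intro!: le_degree)
  finally show ?thesis .
qed

lemma coeff_mp_deriv: "coeff (mp_deriv P) k = real (Suc k) *\<^sub>R coeff P (Suc k)"
proof -
  have "coeff (mp_deriv P) k = (\<Sum>i<degree P. if i = k then real (Suc i) *\<^sub>R coeff P (Suc i) else 0)"
    by (simp add: mp_deriv_def coeff_sum)
  also have "\<dots> = real (Suc k) *\<^sub>R coeff P (Suc k)"
    by (cases "k < degree P") (simp_all add: coeff_eq_0)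
  finally show ?thesis .
qed

lemma coeff_scalar_mp: "coeff (scalar_mp \<alpha>) k = mat (coeff \<alpha> k)"
  by (simp add: scalar_mp_def coeff_map_poly mat_def vec_eq_iff)

lemma star_assoc: "P \<star> Q \<star> R = P \<star> (Q \<star> R)"
proof (rule poly_eqI)
  fix n
  have "coeff (P \<star> Q \<star> R) n
      = (\<Sum>j=0..n. \<Sum>i=0..j. coeff P i ** coeff Q (j - i) ** coeff R (n - j))"
    by (simp add: coeff_star matrix_sum_mult atMost_atLeast0)
  \<comment> \<open>Only the order of summation changes; no commutativity of \<open>**\<close>
    enters.\<close>
  also have "\<dots> = (\<Sum>j=0..n. \<Sum>i=0..n - j. coeff P j ** coeff Q i ** coeff R (n - j - i))"
    by (rule fps_mult_assoc_lemma)
  also have "\<dots> = coeff (P \<star> (Q \<star> R)) n"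
    by (simp add: coeff_star matrix_mult_sum atMost_atLeast0 matrix_mul_assoc)
  finally show "coeff (P \<star> Q \<star> R) n = coeff (P \<star> (Q \<star> R)) n" .
qed

lemma star_distribs:
  "(P + Q) \<star> R = P \<star> R + Q \<star> R" "P \<star> (Q + R) = P \<star> Q + P \<star> R"
  "(P - Q) \<star> R = P \<star> R - Q \<star> R" "P \<star> (Q - R) = P \<star> Q - P \<star> R"
  by (rule poly_eqI, simp add: coeff_star matrix_ring_simps sum.distrib sum_subtractf)+

lemma star_zero [simp]: "0 \<star> P = 0" "P \<star> 0 = 0"
  by (rule poly_eqI, simp add: coeff_star)+

lemma sum_star: "sum f S \<star> P = (\<Sum>i\<in>S. f i \<star> P)"
  by (induction S rule: infinite_finite_induct) (simp_all add: star_distribs)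

lemma coeff_monom_star:
  "coeff (monom A k \<star> P) j = (if j < k then 0 else A ** coeff P (j - k))"
proof -
  have "coeff (monom A k \<star> P) j = (\<Sum>i\<le>j. if i = k then A ** coeff P (j - i) else 0)"
    unfolding coeff_star by (intro sum.cong) auto
  thus ?thesis by simp
qed

lemma coeff_star_const: "coeff (P \<star> const_mp A) j = coeff P j ** A"
proof -
  have "coeff (P \<star> const_mp A) j = (\<Sum>i\<le>j. if i = j then coeff P i ** A else 0)"
    unfolding coeff_star by (intro sum.cong) auto
  thus ?thesis by simp
qed

lemma monom_star_monom: "monom A i \<star> monom B j = monom (A ** B) (i + j)"
  by (rule poly_eqI) (auto simp: coeff_monom_star)

lemma X_mp_0_star [simp]: "X_mp 0 \<star> P = P"
  by (rule poly_eqI) (simp add: coeff_monom_star)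

lemma X_mp_star_X_mp: "X_mp i \<star> (X_mp j \<star> P) = X_mp (i + j) \<star> P"
  by (simp add: star_assoc [symmetric] monom_star_monom)

lemma scalar_star_commute: "scalar_mp \<alpha> \<star> P = P \<star> scalar_mp \<alpha>"
proof (rule poly_eqI)
  fix k
  have "coeff (scalar_mp \<alpha> \<star> P) k = (\<Sum>i\<le>k. coeff P (k - i) ** mat (coeff \<alpha> i))"
    by (simp add: coeff_star coeff_scalar_mp mat_mult_commute)
  also have "\<dots> = (\<Sum>i\<le>k. coeff P i ** mat (coeff \<alpha> (k - i)))"
    by (rule sum.reindex_bij_witness [of _ "\<lambda>i. k - i" "\<lambda>i. k - i"]) auto
  finally show "coeff (scalar_mp \<alpha> \<star> P) k = coeff (P \<star> scalar_mp \<alpha>) k"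
    by (simp add: coeff_star coeff_scalar_mp)
qed

lemma scalar_star_left_commute: "P \<star> (scalar_mp \<alpha> \<star> Q) = scalar_mp \<alpha> \<star> (P \<star> Q)"
  by (metis star_assoc scalar_star_commute)

lemma X_mp_eq_scalar_mp: "X_mp k = scalar_mp (monom 1 k)"
  by (rule poly_eqI) (auto simp: coeff_scalar_mp mat_def vec_eq_iff)

lemma X_mp_star_commute: "X_mp k \<star> P = P \<star> X_mp k"
  by (simp add: X_mp_eq_scalar_mp scalar_star_commute)

lemma X_mp_star_left_commute: "P \<star> (X_mp k \<star> Q) = X_mp k \<star> (P \<star> Q)"
  by (simp add: X_mp_eq_scalar_mp scalar_star_left_commute)

text \<open>The leading coefficients multiply, and that of \<alpha> is a non-zero scalar matrix,
  hence no zero divisor.\<close>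

lemma scalar_star_eq_0:
  assumes "scalar_mp \<alpha> \<star> P = 0" "\<alpha> \<noteq> 0"
  shows "P = 0"
proof (rule ccontr)
  assume "P \<noteq> 0"
  let ?d = "degree \<alpha>" and ?e = "degree P"
  have "coeff (scalar_mp \<alpha> \<star> P) (?d + ?e)
      = (\<Sum>i\<le>?d + ?e. if i = ?d then mat (coeff \<alpha> i) ** coeff P (?d + ?e - i) else 0)"
    unfolding coeff_star coeff_scalar_mp
  proof (intro sum.cong refl)
    fix i assume "i \<in> {..?d + ?e}"
    consider "i < ?d" | "i = ?d" | "i > ?d" by linarith
    then show "mat (coeff \<alpha> i) ** coeff P (?d + ?e - i)
        = (if i = ?d then mat (coeff \<alpha> i) ** coeff P (?d + ?e - i) else 0)"
      by cases (simp_all add: coeff_eq_0 vec_eq_iff mat_mult_nth)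
  qed
  then have "mat (lead_coeff \<alpha>) ** lead_coeff P = 0"
    using assms(1) by simp
  with \<open>\<alpha> \<noteq> 0\<close> have "lead_coeff P = 0"
    by (simp add: vec_eq_iff mat_mult_nth)
  with \<open>P \<noteq> 0\<close> show False by simp
qed

section \<open>Differentiation of matrix polynomials\<close>

lemma mp_deriv_add: "mp_deriv (P + Q) = mp_deriv P + mp_deriv Q"
  by (rule poly_eqI) (simp add: coeff_mp_deriv scaleR_add_right)

lemma mp_deriv_diff: "mp_deriv (P - Q) = mp_deriv P - mp_deriv Q"
  by (rule poly_eqI) (simp add: coeff_mp_deriv scaleR_diff_right)

lemma mp_deriv_const [simp]: "mp_deriv (const_mp A) = 0"
  by (rule poly_eqI) (simp add: coeff_mp_deriv)

lemma mp_deriv_star: "mp_deriv (P \<star> Q) = mp_deriv P \<star> Q + P \<star> mp_deriv Q"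
proof (rule poly_eqI)
  fix k
  let ?f = "\<lambda>i. coeff P i ** coeff Q (Suc k - i)"
  have "(\<Sum>i\<le>Suc k. real (Suc k) *\<^sub>R ?f i)
      = (\<Sum>i\<le>Suc k. real i *\<^sub>R ?f i) + (\<Sum>i\<le>Suc k. real (Suc k - i) *\<^sub>R ?f i)"
    unfolding sum.distrib [symmetric]
    by (intro sum.cong refl) (simp add: of_nat_diff flip: scaleR_add_left)
  also have "(\<Sum>i\<le>Suc k. real i *\<^sub>R ?f i) = coeff (mp_deriv P \<star> Q) k"
    by (simp add: sum.atMost_Suc_shift coeff_star coeff_mp_deriv matrix_scaleR_mult del: sum.atMost_Suc)
  also have "(\<Sum>i\<le>Suc k. real (Suc k - i) *\<^sub>R ?f i) = coeff (P \<star> mp_deriv Q) k"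
    by (simp add: coeff_star coeff_mp_deriv matrix_scaleR_mult Suc_diff_le of_nat_diff add_diff_eq)
  finally show "coeff (mp_deriv (P \<star> Q)) k = coeff (mp_deriv P \<star> Q + P \<star> mp_deriv Q) k"
    by (simp add: coeff_mp_deriv coeff_star scaleR_sum_right del: sum.atMost_Suc of_nat_Suc)
qed

lemma mp_deriv_scalar_mp: "mp_deriv (scalar_mp \<alpha>) = scalar_mp (pderiv \<alpha>)"
  by (rule poly_eqI)
    (simp add: coeff_mp_deriv coeff_scalar_mp coeff_pderiv scaleR_eq_mat_mult flip: mat_mult)

lemma mp_deriv_X_mp: "mp_deriv (X_mp k) = monom (mat (of_nat k)) (k - 1)"
  by (rule poly_eqI) (cases k, auto simp: coeff_mp_deriv scaleR_eq_mat_mult)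

text \<open>Serves to show that a functional with zero derivative vanishes: its values on
  derivatives are all its values.\<close>

lemma ex_antiderivative: "\<exists>S. mp_deriv S = P"
proof
  show "mp_deriv (Abs_poly (\<lambda>k. (1 / real k) *\<^sub>R (if k = 0 then 0 else coeff P (k - 1)))) = P"
  proof (rule poly_eqI)
    fix k
    have "\<forall>\<^sub>\<infinity> k. (1 / real k) *\<^sub>R (if k = 0 then 0 else coeff P (k - 1)) = 0"
      unfolding MOST_nat by (rule exI [of _ "Suc (degree P)"]) (auto simp: coeff_eq_0)
    then show "coeff (mp_deriv (Abs_poly (\<lambda>k. (1 / real k) *\<^sub>R
        (if k = 0 then 0 else coeff P (k - 1))))) k = coeff P k"
      by (simp add: coeff_mp_deriv Abs_poly_inverse)
  qed
qed

lemma mp_deriv_eq_0: "mp_deriv P = 0 \<Longrightarrow> P = const_mp (coeff P 0)"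
proof (rule poly_eqI)
  fix k assume "mp_deriv P = 0"
  then have "coeff (mp_deriv P) (k - 1) = 0" by simp
  then show "coeff P k = coeff (const_mp (coeff P 0)) k"
    by (cases k) (auto simp: coeff_mp_deriv simp del: of_nat_Suc)
qed

section \<open>Functionals and the Pearson equation\<close>

lemma left_linearD:
  assumes "left_linear u"
  shows left_linear_add: "u (P + Q) = u P + u Q"
    and left_linear_const_star: "u (const_mp A \<star> P) = A ** u P"
    and left_linear_zero: "u 0 = 0"
    and left_linear_diff: "u (P - Q) = u P - u Q"
proof -
  show *: "u (P + Q) = u P + u Q" for P Q
    using assms by (simp add: left_linear_def)
  show "u (const_mp A \<star> P) = A ** u P"
    using assms by (simp add: left_linear_def)
  show "u 0 = 0"
    using * [of 0 0] by simp
  show "u (P - Q) = u P - u Q"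
    using * [of "P - Q" Q] by simp
qed

lemma left_linear_sum:
  assumes "left_linear u"
  shows "u (sum f S) = (\<Sum>i\<in>S. u (f i))"
  by (induction S rule: infinite_finite_induct)
    (simp_all add: left_linear_zero [OF assms] left_linear_add [OF assms])

lemma left_linear_monom_star:
  assumes "left_linear u"
  shows "u (monom A k \<star> P) = A ** u (X_mp k \<star> P)"
proof -
  have "monom A k \<star> P = const_mp A \<star> (X_mp k \<star> P)"
    by (simp add: star_assoc [symmetric] monom_star_monom)
  then show ?thesis
    by (simp add: left_linear_const_star [OF assms])
qed

lemma star_eq_sum:
  assumes "degree Q \<le> N"
  shows "Q \<star> P = (\<Sum>k\<le>N. monom (coeff Q k) k \<star> P)"
  by (subst poly_as_sum_of_monoms' [OF assms, symmetric]) (rule sum_star)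

lemma left_linear_star:
  assumes "left_linear u" "degree Q \<le> N"
  shows "u (Q \<star> P) = (\<Sum>k\<le>N. coeff Q k ** u (X_mp k \<star> P))"
  unfolding star_eq_sum [OF assms(2)] left_linear_sum [OF assms(1)]
  by (intro sum.cong refl left_linear_monom_star assms(1))

lemma star_X_mp_0 [simp]: "P \<star> X_mp 0 = P"
  by (rule poly_eqI) (simp add: coeff_star_const)

section \<open>Right multiplication and derivative of functionals\<close>

lemma fun_times_eq_sum:
  assumes "degree Q \<le> N"
  shows "fun_times u Q P = (\<Sum>k\<le>N. u (X_mp k \<star> P) ** coeff Q k)"
  unfolding fun_times_def
  by (rule sum.mono_neutral_left) (use assms in \<open>auto simp: coeff_eq_0\<close>)

lemma fun_times_monom: "fun_times u (monom A k) P = u (X_mp k \<star> P) ** A"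
proof -
  have "fun_times u (monom A k) P = (\<Sum>i\<le>k. if i = k then u (X_mp i \<star> P) ** A else 0)"
    unfolding fun_times_eq_sum [OF degree_monom_le] by (intro sum.cong) auto
  then show ?thesis by simp
qed

lemma fun_times_add: "fun_times u (Q + R) P = fun_times u Q P + fun_times u R P"
proof -
  have *: "degree (Q + R) \<le> max (degree Q) (degree R)" "degree Q \<le> max (degree Q) (degree R)"
    "degree R \<le> max (degree Q) (degree R)"
    by (auto simp: degree_add_le_max)
  show ?thesis
    unfolding * [THEN fun_times_eq_sum] by (simp add: matrix_add_ldistrib sum.distrib)
qed

lemma fun_times_0 [simp]: "fun_times u 0 P = 0"
  by (simp add: fun_times_def)

lemma fun_times_sum: "fun_times u (sum f S) P = (\<Sum>i\<in>S. fun_times u (f i) P)"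
  by (induction S rule: infinite_finite_induct) (simp_all add: fun_times_add)

text \<open>Coefficients act on values of \<open>u\<close> from the right, as in a right module:
  both sides are sums of \<open>u (X_mp (i + j) \<star> P)\<close> times
  \<open>coeff Q i ** coeff R j\<close>.\<close>

lemma fun_times_star: "fun_times u (Q \<star> R) = fun_times (fun_times u Q) R"
proof
  fix P
  have "fun_times u (Q \<star> R) P
      = (\<Sum>i\<le>degree Q. \<Sum>j\<le>degree R. u (X_mp (i + j) \<star> P) ** (coeff Q i ** coeff R j))"
    by (simp add: mp_times_def fun_times_sum fun_times_monom)
  also have "\<dots> = fun_times (fun_times u Q) R P"
    by (subst sum.swap) (simp add: fun_times_def X_mp_star_X_mp matrix_sum_mult matrix_mul_assoc)
  finally show "fun_times u (Q \<star> R) P = fun_times (fun_times u Q) R P" .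
qed

lemma left_linear_fun_times:
  assumes "left_linear u"
  shows "left_linear (fun_times u Q)"
  unfolding left_linear_def
proof (intro conjI allI)
  fix P R A
  show "fun_times u Q (P + R) = fun_times u Q P + fun_times u Q R"
    by (simp add: fun_times_def star_distribs left_linear_add [OF assms] matrix_add_rdistrib
        sum.distrib)
  have "X_mp k \<star> (const_mp A \<star> P) = const_mp A \<star> (X_mp k \<star> P)" for k
    by (rule X_mp_star_left_commute [symmetric])
  then show "fun_times u Q (const_mp A \<star> P) = A ** fun_times u Q P"
    by (simp add: fun_times_def left_linear_const_star [OF assms] matrix_mult_sum matrix_mul_assoc)
qed

lemma degree_scalar_mp_le: "degree (scalar_mp \<alpha>) \<le> degree \<alpha>"
  by (rule degree_le) (simp add: coeff_scalar_mp coeff_eq_0 mat_def vec_eq_iff)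

text \<open>Scalar coefficients commute with the values of \<open>u\<close>, so left linearity moves
  them into the argument.\<close>

lemma fun_times_scalar_mp:
  assumes "left_linear u"
  shows "fun_times u (scalar_mp \<alpha>) P = u (scalar_mp \<alpha> \<star> P)"
  by (simp add: fun_times_def left_linear_star [OF assms, of "scalar_mp \<alpha>", OF order_refl]
      coeff_scalar_mp mat_mult_commute)

lemma mp_deriv_X_mp_star:
  "mp_deriv (X_mp k \<star> P) = monom (mat (of_nat k)) (k - 1) \<star> P + X_mp k \<star> mp_deriv P"
  by (simp add: mp_deriv_star mp_deriv_X_mp)

text \<open>Leibniz rule for functionals: apply \<open>u\<close> to (x^k P)' = k x^(k-1) P + x^k P',
  multiply by the k-th coefficient of \<open>Q\<close> and sum over k.\<close>

lemma fun_deriv_fun_times: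
  assumes "left_linear u"
  shows "fun_deriv (fun_times u Q) P = fun_times (fun_deriv u) Q P + fun_times u (mp_deriv Q) P"
proof -
  define N where "N = degree Q"
  \<comment> \<open>The bounds differ by one so that a shift of the summation index turns the sum up
    to \<open>Suc N\<close> into the one for \<open>mp_deriv Q\<close> up to
    \<open>N\<close>.\<close>
  have N: "degree Q \<le> Suc N" "degree (mp_deriv Q) \<le> N"
    by (auto simp: N_def intro!: degree_le simp: coeff_mp_deriv coeff_eq_0)
  have "u (mp_deriv (X_mp k \<star> P))
      = of_nat k *\<^sub>R u (X_mp (k - 1) \<star> P) + u (X_mp k \<star> mp_deriv P)" for k
    by (simp add: mp_deriv_X_mp_star left_linear_add [OF assms]
        left_linear_monom_star [OF assms, of "mat (of_nat k)"] scaleR_eq_mat_mult)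
  then have "fun_times (fun_deriv u) Q P
      = - (\<Sum>k\<le>Suc N. of_nat k *\<^sub>R u (X_mp (k - 1) \<star> P) ** coeff Q k)
        - (\<Sum>k\<le>Suc N. u (X_mp k \<star> mp_deriv P) ** coeff Q k)"
    by (simp add: fun_times_eq_sum [OF N(1)] fun_deriv_def matrix_add_rdistrib matrix_diff_distrib
        sum.distrib sum_subtractf sum_negf del: sum.atMost_Suc)
  also have "(\<Sum>k\<le>Suc N. of_nat k *\<^sub>R u (X_mp (k - 1) \<star> P) ** coeff Q k)
      = fun_times u (mp_deriv Q) P"
    by (simp add: sum.atMost_Suc_shift fun_times_eq_sum [OF N(2)] coeff_mp_deriv matrix_scaleR_mult
        del: sum.atMost_Suc)
  also have "(\<Sum>k\<le>Suc N. u (X_mp k \<star> mp_deriv P) ** coeff Q k) = fun_times u Q (mp_deriv P)"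
    by (rule fun_times_eq_sum [OF N(1), symmetric])
  finally show ?thesis
    by (simp add: fun_deriv_def)
qed

section \<open>The Pearson equation and its passage from \<open>u\<close> to
  \<open>fun_times u (scalar_mp \<alpha>)\<close>\<close>

lemma pearsonD:
  assumes "pearson u \<alpha> \<Psi>"
  shows "\<alpha> \<noteq> 0" "degree \<alpha> \<le> 2" "degree \<Psi> \<le> 1"
    "fun_deriv (fun_times u (scalar_mp \<alpha>)) = fun_times u \<Psi>"
  using assms by (auto simp: pearson_def)

lemma sum_atMost_2: "sum f {..2::nat} = f 0 + f 1 + f 2"
  by (simp add: numeral_2_eq_2)

lemma fun_times_scalar_mp_quadratic:
  assumes "degree \<alpha> \<le> 2"
  shows "fun_times u (scalar_mp \<alpha>) P = mat (coeff \<alpha> 0) ** u P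
    + mat (coeff \<alpha> 1) ** u (X_mp 1 \<star> P) + mat (coeff \<alpha> 2) ** u (X_mp 2 \<star> P)"
  using fun_times_eq_sum [OF order_trans [OF degree_scalar_mp_le assms]]
  by (simp add: sum_atMost_2 coeff_scalar_mp mat_mult_commute)

lemma pearson_apply:
  assumes "left_linear u" "pearson u \<alpha> \<Psi>"
  shows "u (scalar_mp \<alpha> \<star> mp_deriv P)
    = - (u P ** coeff \<Psi> 0 + u (X_mp 1 \<star> P) ** coeff \<Psi> 1)"
proof -
  have "- u (scalar_mp \<alpha> \<star> mp_deriv P) = fun_times u \<Psi> P"
    by (simp add: fun_deriv_def fun_times_scalar_mp [OF assms(1)] flip: pearsonD(4) [OF assms(2)])
  also have "\<dots> = u P ** coeff \<Psi> 0 + u (X_mp 1 \<star> P) ** coeff \<Psi> 1"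
    by (simp add: fun_times_eq_sum [OF pearsonD(3) [OF assms(2)]])
  finally show ?thesis by (metis minus_minus)
qed

text \<open>With v = u\<alpha> the Leibniz rule gives D(v\<alpha>) = (Dv)\<alpha> + v\<alpha>'. Here
  Dv = u\<Psi>, and u\<Psi>\<alpha> = v\<Psi> because the scalar polynomial \<alpha> commutes with
  \<Psi>.\<close>

lemma pearson_fun_times:
  assumes "left_linear u" "pearson u \<alpha> \<Psi>"
  shows "pearson (fun_times u (scalar_mp \<alpha>)) \<alpha> (\<Psi> + scalar_mp (pderiv \<alpha>))"
proof -
  let ?v = "fun_times u (scalar_mp \<alpha>)"
  have "degree (pderiv \<alpha>) \<le> 1"
    using pearsonD(2) [OF assms(2)] unfolding degree_pderiv by arith
  then have "degree (\<Psi> + scalar_mp (pderiv \<alpha>)) \<le> 1"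
    using pearsonD(3) [OF assms(2)]
    by (intro degree_add_le) (auto intro: order_trans [OF degree_scalar_mp_le])
  moreover have "fun_deriv (fun_times ?v (scalar_mp \<alpha>)) = fun_times ?v (\<Psi> + scalar_mp (pderiv \<alpha>))"
  proof
    fix P
    have "fun_times (fun_deriv ?v) (scalar_mp \<alpha>) P = fun_times ?v \<Psi> P"
      by (simp add: pearsonD(4) [OF assms(2)] scalar_star_commute flip: fun_times_star)
    then show "fun_deriv (fun_times ?v (scalar_mp \<alpha>)) P
        = fun_times ?v (\<Psi> + scalar_mp (pderiv \<alpha>)) P"
      by (simp add: fun_deriv_fun_times left_linear_fun_times assms(1) fun_times_add
          mp_deriv_scalar_mp)
  qed
  ultimately show ?thesis
    using pearsonD [OF assms(2)] by (simp add: pearson_def)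
qed

text \<open>The linear coefficient of \<alpha>' is twice the quadratic coefficient of
  \<alpha>.\<close>

lemma M_mat_shift: "M_mat \<alpha> (\<Psi> + scalar_mp (pderiv \<alpha>)) k = M_mat \<alpha> \<Psi> (k + 2)"
  by (simp add: M_mat_def coeff_scalar_mp coeff_pderiv numeral_2_eq_2 algebra_simps flip: mat_add)

text \<open>The indices k-1, ..., 2k-1 of the product for the new equation become k+1, ..., 2k+1 in
  terms of the old one, so only the factor M_k is missing. This is how the normalization passes from
  \<open>u\<close> to u\<alpha>.\<close>

lemma V_mat_shift:
  assumes "k \<ge> 0"
  shows "V_mat \<alpha> \<Psi> k = M_mat \<alpha> \<Psi> k ** V_mat \<alpha> (\<Psi> + scalar_mp (pderiv \<alpha>)) (k - 1)"
proof -
  have shift: "map (\<lambda>i. i + 2) [a..b] = [a + 2..b + 2]" for a b :: int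
    by (induction a b rule: upto.induct) (simp add: upto.simps)
  have "[k..2 * k + 1] = k # map (\<lambda>i. i + 2) [k - 1..2 * (k - 1) + 1]"
    unfolding shift using assms upto_rec1 [of k "2 * k + 1"] by (simp add: algebra_simps)
  then show ?thesis
    by (simp add: V_mat_def foldr_map o_def M_mat_shift)
qed

lemma M_mat_commute: "coeff \<Psi> 1 ** M_mat \<alpha> \<Psi> k = M_mat \<alpha> \<Psi> k ** coeff \<Psi> 1"
  by (simp add: M_mat_def matrix_ring_simps mat_mult_commute)

text \<open>Every factor differs from \<psi>_1 by a scalar matrix only.\<close>

lemma V_mat_commute: "coeff \<Psi> 1 ** V_mat \<alpha> \<Psi> k = V_mat \<alpha> \<Psi> k ** coeff \<Psi> 1"
proof -
  have "coeff \<Psi> 1 ** foldr (\<lambda>i A. M_mat \<alpha> \<Psi> i ** A) is (mat 1)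
      = foldr (\<lambda>i A. M_mat \<alpha> \<Psi> i ** A) is (mat 1) ** coeff \<Psi> 1" for "is"
  proof (induction "is")
    case (Cons i "is")
    have *: "coeff \<Psi> 1 ** (M_mat \<alpha> \<Psi> i ** A) = M_mat \<alpha> \<Psi> i ** (coeff \<Psi> 1 ** A)" for A :: "'a cmat"
      by (simp only: matrix_mul_assoc M_mat_commute)
    then show ?case
      by (simp only: foldr.simps o_apply * Cons.IH flip: matrix_mul_assoc)
  qed simp
  then show ?thesis by (simp add: V_mat_def)
qed

lemma invertible_V_mat:
  assumes "\<And>i. i \<ge> k \<Longrightarrow> invertible (M_mat \<alpha> \<Psi> i)"
  shows "invertible (V_mat \<alpha> \<Psi> k)"
proof -
  have *: "invertible (foldr (\<lambda>i A. M_mat \<alpha> \<Psi> i ** A) is (mat 1))" if "\<And>i. i \<in> set is \<Longrightarrow> i \<ge> k" for "is"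
    using that
  proof (induction "is")
    case Nil
    then show ?case by (simp add: invertible_mat)
  next
    case (Cons i "is")
    then show ?case by (auto intro!: invertible_mult assms)
  qed
  show ?thesis
    unfolding V_mat_def by (rule *) simp
qed

text \<open>Write x^k P' = (x^k P)' - k x^(k-1) P. The Pearson equation evaluates \<open>v\<close>
  on the first term, the expansion of \<alpha> on the second. Orthogonality leaves
  \<open>u (X_mp (Suc k) \<star> P)\<close> with the factors \<psi>_1 and k\<alpha>_2, which add up
  to M_k.\<close>

lemma orthogonal_mp_deriv:
  assumes "left_linear u" "pearson u \<alpha> \<Psi>" and orth: "\<And>k. k < Suc n \<Longrightarrow> u (X_mp k \<star> P) = 0"
  defines "v \<equiv> fun_times u (scalar_mp \<alpha>)"
  shows "\<And>k. k < n \<Longrightarrow> v (X_mp k \<star> mp_deriv P) = 0"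
    and "v (X_mp n \<star> mp_deriv P) = - (u (X_mp (Suc n) \<star> P) ** M_mat \<alpha> \<Psi> (int n))"
proof -
  have v_lin: "left_linear v"
    unfolding v_def by (rule left_linear_fun_times) (rule assms(1))
  have *: "v (X_mp k \<star> mp_deriv P) = - (u (X_mp (Suc k) \<star> P) ** M_mat \<alpha> \<Psi> (int k))" if "k \<le> n" for k
  proof -
    \<comment> \<open>Orthogonality kills x^(k-1) P and x^k P, so only the quadratic coefficient of
      \<alpha> contributes.\<close>
    have v: "v (X_mp (k - 1) \<star> P) = mat (coeff \<alpha> 2) ** u (X_mp (Suc k) \<star> P)" if "k > 0"
      using \<open>k \<le> n\<close> \<open>k > 0\<close>
      by (simp add: v_def fun_times_scalar_mp_quadratic [OF pearsonD(2) [OF assms(2)]]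
          X_mp_star_X_mp orth)
    have "v (X_mp k \<star> mp_deriv P)
        = v (mp_deriv (X_mp k \<star> P)) - mat (of_nat k) ** v (X_mp (k - 1) \<star> P)"
      by (simp add: mp_deriv_X_mp_star left_linear_add [OF v_lin]
          left_linear_monom_star [OF v_lin, of "mat (of_nat k)"])
    also have "v (mp_deriv (X_mp k \<star> P)) = - (u (X_mp (Suc k) \<star> P) ** coeff \<Psi> 1)"
      using \<open>k \<le> n\<close>
      by (simp add: v_def fun_times_scalar_mp [OF assms(1)] pearson_apply [OF assms(1,2)]
          X_mp_star_X_mp orth)
    also have "mat (of_nat k) ** v (X_mp (k - 1) \<star> P)
        = u (X_mp (Suc k) \<star> P) ** mat (of_nat k * coeff \<alpha> 2)"
    proof (cases "k = 0")
      \<comment> \<open>Here the truncated \<open>k - 1\<close> is 0, but the factor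
        \<open>mat (of_nat k)\<close> vanishes.\<close>
      case True
      then show ?thesis by (simp add: mat_0)
    next
      case False
      then show ?thesis
        using v by (simp add: matrix_mul_assoc flip: mat_mult) (rule mat_mult_commute)
    qed
    finally show ?thesis
      by (simp add: M_mat_def matrix_add_ldistrib)
  qed
  show "v (X_mp k \<star> mp_deriv P) = 0" if "k < n" for k
    using * [of k] orth [of "Suc k"] that by simp
  show "v (X_mp n \<star> mp_deriv P) = - (u (X_mp (Suc n) \<star> P) ** M_mat \<alpha> \<Psi> (int n))"
    by (rule *) simp
qed

text \<open>An orthogonal polynomial of degree 0 is an invertible constant, and its value under
  \<open>u\<close> is that constant times the moment.\<close>

lemma invertible_moment_0:
  assumes "left_linear u" "\<forall>n. \<exists>P. orth_poly u n P"
  shows "invertible (u (X_mp 0))"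
proof -
  obtain P where P: "orth_poly u 0 P" using assms(2) by blast
  then have "P = const_mp (coeff P 0) \<star> X_mp 0"
    by (metis degree_0_id monom_0 orth_poly_def star_X_mp_0)
  then have "u P = coeff P 0 ** u (X_mp 0)"
    using left_linear_const_star [OF assms(1)] by metis
  moreover have "invertible (u P)" "invertible (coeff P 0)"
    using P by (auto simp: orth_poly_def)
  ultimately show ?thesis
    by (metis invertible_left_inverse invertible_right_inverse matrix_mul_assoc)
qed

text \<open>Invertibility of M_n is what makes the value of
  \<open>fun_times u (scalar_mp \<alpha>)\<close> on x^n P' non-singular.\<close>

lemma orth_poly_mp_deriv:
  assumes "left_linear u" "pearson u \<alpha> \<Psi>" "orth_poly u (Suc n) P"
    and "invertible (M_mat \<alpha> \<Psi> (int n))"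
  shows "orth_poly (fun_times u (scalar_mp \<alpha>)) n (mp_deriv P)"
proof -
  have P: "degree P = Suc n" "invertible (coeff P (Suc n))" "\<And>k. k < Suc n \<Longrightarrow> u (X_mp k \<star> P) = 0"
    "invertible (u (X_mp (Suc n) \<star> P))"
    using assms(3) by (auto simp: orth_poly_def)
  have coeff: "coeff (mp_deriv P) n = mat (of_nat (Suc n)) ** coeff P (Suc n)"
    by (simp add: coeff_mp_deriv scaleR_eq_mat_mult)
  have inv: "invertible (coeff (mp_deriv P) n)"
    unfolding coeff by (intro invertible_mult invertible_mat P(2)) (simp del: of_nat_Suc)
  have "coeff (mp_deriv P) n \<noteq> 0"
    using inv by (rule invertible_imp_nonzero)
  then have deg: "degree (mp_deriv P) = n"
    by (intro antisym le_degree degree_le) (auto simp: coeff_mp_deriv coeff_eq_0 P(1))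
  have "invertible (- (u (X_mp (Suc n) \<star> P) ** M_mat \<alpha> \<Psi> (int n)))"
  proof -
    have "- (u (X_mp (Suc n) \<star> P) ** M_mat \<alpha> \<Psi> (int n))
        = mat (-1) ** (u (X_mp (Suc n) \<star> P) ** M_mat \<alpha> \<Psi> (int n))"
      by (simp add: vec_eq_iff mat_mult_nth)
    then show ?thesis
      by (auto intro!: invertible_mult P(4) assms(4) invertible_mat)
  qed
  then show ?thesis
    using inv deg orthogonal_mp_deriv [OF assms(1,2) P(3)] by (simp add: orth_poly_def)
qed

text \<open>Tested on the orthogonal polynomial of degree \<open>degree R\<close>, the functional
  only sees the leading coefficient of \<open>R\<close>.\<close>

lemma fun_times_eq_0:
  assumes "\<forall>n. \<exists>P. orth_poly u n P" "\<And>P. fun_times u R P = 0"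
  shows "R = 0"
proof -
  obtain P where P: "orth_poly u (degree R) P" using assms(1) by blast
  have "0 = (\<Sum>k\<le>degree R. u (X_mp k \<star> P) ** coeff R k)"
    using assms(2) [of P] by (simp add: fun_times_def)
  also have "\<dots> = (\<Sum>k\<le>degree R. if k = degree R then u (X_mp k \<star> P) ** coeff R k else 0)"
    using P by (intro sum.cong) (auto simp: orth_poly_def)
  also have "\<dots> = u (X_mp (degree R) \<star> P) ** lead_coeff R"
    by simp
  finally have "lead_coeff R = 0"
    using P invertible_mult_eq_0 by (metis orth_poly_def)
  then show ?thesis by simp
qed

section \<open>The differential operator and non-singularity of the matrices M_k\<close>

definition pearson_op :: "complex poly \<Rightarrow> 'm::finite mpoly \<Rightarrow> 'm mpoly \<Rightarrow> 'm mpoly" where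
  "pearson_op \<alpha> \<Psi> y = scalar_mp \<alpha> \<star> mp_deriv (mp_deriv y) + \<Psi> \<star> mp_deriv y"

lemma pearson_op_add: "pearson_op \<alpha> \<Psi> (y + z) = pearson_op \<alpha> \<Psi> y + pearson_op \<alpha> \<Psi> z"
  by (simp add: pearson_op_def mp_deriv_add star_distribs)

lemma pearson_op_diff: "pearson_op \<alpha> \<Psi> (y - z) = pearson_op \<alpha> \<Psi> y - pearson_op \<alpha> \<Psi> z"
  by (simp add: pearson_op_def mp_deriv_diff star_distribs)

text \<open>The operator is triangular with respect to the degree: \<alpha>y'' contributes
  k(k-1)\<alpha>_2 and \<Psi>y' contributes k\<psi>_1, together k M_(k-1).\<close>

lemma coeff_pearson_op:
  assumes "degree \<alpha> \<le> 2" "degree \<Psi> \<le> 1" "\<And>j. j > k \<Longrightarrow> coeff y j = 0"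
  shows "coeff (pearson_op \<alpha> \<Psi> y) k = real k *\<^sub>R (M_mat \<alpha> \<Psi> (int k - 1) ** coeff y k)"
proof -
  have \<alpha>: "scalar_mp \<alpha> \<star> P = (\<Sum>i\<le>2. monom (mat (coeff \<alpha> i)) i \<star> P)" for P
    using star_eq_sum [OF order_trans [OF degree_scalar_mp_le assms(1)]] by (simp add: coeff_scalar_mp)
  consider "k = 0" | "k = Suc 0" | m where "k = Suc (Suc m)"
    by (metis not0_implies_Suc)
  then show ?thesis
  proof cases
    case 3
    have "coeff (pearson_op \<alpha> \<Psi> y) k = mat (coeff \<alpha> 2) ** (real (Suc m) *\<^sub>R (real k *\<^sub>R coeff y k))
        + coeff \<Psi> 1 ** (real k *\<^sub>R coeff y k)"
      by (simp add: 3 pearson_op_def \<alpha> sum_atMost_2 star_eq_sum [OF assms(2)] coeff_monom_star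
          coeff_mp_deriv assms(3) del: of_nat_Suc)
    also have "\<dots> = real k *\<^sub>R ((coeff \<Psi> 1 + mat (of_nat (Suc m) * coeff \<alpha> 2)) ** coeff y k)"
      unfolding scaleR_eq_mat_mult matrix_add_rdistrib matrix_add_ldistrib
        mat_left_commute [of "coeff \<Psi> 1"]
      by (simp add: vec_eq_iff mat_mult_nth)
    finally show ?thesis
      by (simp add: M_mat_def 3)
  qed (simp_all add: pearson_op_def \<alpha> sum_atMost_2 star_eq_sum [OF assms(2)] coeff_monom_star
      coeff_mp_deriv assms(3) M_mat_def)
qed

text \<open>Triangular elimination from the top: a monomial with coefficient obtained from the
  inverse of (n+1)M_n removes the term of degree n+1. In degree 0 the diagonal factor is 0, so a
  constant \<open>K\<close> remains.\<close>

lemma pearson_op_surj_mod_const: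
  assumes "degree \<alpha> \<le> 2" "degree \<Psi> \<le> 1" "\<And>k. k < n \<Longrightarrow> invertible (M_mat \<alpha> \<Psi> (int k))"
    and "degree F \<le> n"
  shows "\<exists>y K. degree y \<le> n \<and> pearson_op \<alpha> \<Psi> y - F = const_mp K"
  using assms(3,4)
proof (induction n arbitrary: F)
  case 0
  then have "F = const_mp (coeff F 0)"
    by (metis degree_0_id le_zero_eq monom_0)
  then have "pearson_op \<alpha> \<Psi> 0 - F = const_mp (- coeff F 0)"
    using pearson_op_diff [of \<alpha> \<Psi> 0 0] by (metis diff_0 diff_self minus_monom)
  then show ?case
    by (metis degree_0 order_refl)
next
  case (Suc n)
  define y where "y = monom ((1 / real (Suc n)) *\<^sub>R
      (matrix_inv (M_mat \<alpha> \<Psi> (int n)) ** coeff F (Suc n))) (Suc n)"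
  have y: "coeff y j = 0" if "j > Suc n" for j
    using that by (simp add: y_def)
  have "coeff (F - pearson_op \<alpha> \<Psi> y) j = 0" if "j > n" for j
  proof (cases "j = Suc n")
    case True
    have "coeff (pearson_op \<alpha> \<Psi> y) (Suc n) = real (Suc n) *\<^sub>R (M_mat \<alpha> \<Psi> (int n) ** coeff y (Suc n))"
      using coeff_pearson_op [OF assms(1,2) y] by simp
    moreover have "M_mat \<alpha> \<Psi> (int n) ** matrix_inv (M_mat \<alpha> \<Psi> (int n)) = mat 1"
      using Suc.prems(1) [of n] by (simp add: matrix_inv_mult)
    ultimately show ?thesis
      by (simp add: True y_def matrix_scaleR_mult matrix_mul_assoc del: of_nat_Suc)
  next
    case False
    with that have "j > Suc n" by simp
    then show ?thesis
      using coeff_pearson_op [OF assms(1,2), of j y] y Suc.prems(2) by (simp add: coeff_eq_0)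
  qed
  then have "degree (F - pearson_op \<alpha> \<Psi> y) \<le> n"
    by (intro degree_le) blast
  with Suc.IH Suc.prems(1) obtain z K where
    z: "degree z \<le> n" "pearson_op \<alpha> \<Psi> z - (F - pearson_op \<alpha> \<Psi> y) = const_mp K"
    by (metis less_SucI)
  have "degree (y + z) \<le> Suc n"
    using z(1) unfolding y_def by (intro degree_add_le degree_monom_le) auto
  moreover have "pearson_op \<alpha> \<Psi> (y + z) - F = const_mp K"
    unfolding z(2) [symmetric] by (simp add: pearson_op_add)
  ultimately show ?case by blast
qed

text \<open>Leibniz rule for the product of v = u\<alpha> with y', where Dv = u\<Psi>.\<close>

lemma fun_deriv_pearson_op:
  assumes "left_linear u" "pearson u \<alpha> \<Psi>"
  shows "fun_deriv (fun_times u (scalar_mp \<alpha> \<star> mp_deriv y)) = fun_times u (pearson_op \<alpha> \<Psi> y)"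
proof
  fix P
  have "fun_deriv (fun_times (fun_times u (scalar_mp \<alpha>)) (mp_deriv y)) P
      = fun_times (fun_times u \<Psi>) (mp_deriv y) P
        + fun_times (fun_times u (scalar_mp \<alpha>)) (mp_deriv (mp_deriv y)) P"
    by (simp add: fun_deriv_fun_times left_linear_fun_times assms(1) pearsonD(4) [OF assms(2)])
  then show "fun_deriv (fun_times u (scalar_mp \<alpha> \<star> mp_deriv y)) P
      = fun_times u (pearson_op \<alpha> \<Psi> y) P"
    by (simp add: fun_times_star pearson_op_def fun_times_add add.commute)
qed

lemma invertible_M_mat:
  fixes u :: "'m::finite mfunctional"
  assumes "left_linear u" "\<forall>n. \<exists>P. orth_poly u n P" "pearson u \<alpha> \<Psi>"
  shows "invertible (M_mat \<alpha> \<Psi> (int k))"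
proof (induction k rule: less_induct)
  case (less k)
  note \<alpha> = pearsonD [OF assms(3)]
  show ?case
  proof (rule ccontr)
    assume "\<not> invertible (M_mat \<alpha> \<Psi> (int k))"
    then obtain C :: "'m cmat" where C: "C \<noteq> 0" "M_mat \<alpha> \<Psi> (int k) ** C = 0"
      by (rule not_invertible_imp_right_annihilator)
    \<comment> \<open>The top coefficient of the image of \<open>z\<close> is (k+1) M_k C = 0, so
      the operator lowers the degree of \<open>z\<close>.\<close>
    define z where "z = monom C (Suc k)"
    have z: "coeff z j = 0" if "j > Suc k" for j
      using that by (simp add: z_def)
    have "coeff (pearson_op \<alpha> \<Psi> z) j = 0" if "j > k" for j
      using coeff_pearson_op [OF \<alpha>(2,3), of j z] that z C(2)
      by (cases "j = Suc k") (simp_all add: z_def)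
    then have "degree (pearson_op \<alpha> \<Psi> z) \<le> k"
      by (intro degree_le) blast
    \<comment> \<open>By minimality of \<open>k\<close> all M_j with j < k are invertible, so a
      polynomial \<open>x\<close> of degree at most \<open>k\<close> matches the image of
      \<open>z\<close> up to a constant.\<close>
    with pearson_op_surj_mod_const [OF \<alpha>(2,3) less.IH] obtain x K where
      x: "degree x \<le> k" "pearson_op \<alpha> \<Psi> x - pearson_op \<alpha> \<Psi> z = const_mp K"
      by blast
    define y where "y = x - z"
    define w where "w = fun_times u (scalar_mp \<alpha> \<star> mp_deriv y)"
    have w: "fun_deriv w P = u P ** K" for P
      using fun_deriv_pearson_op [OF assms(1,3), of y] x(2)
      by (simp add: w_def y_def pearson_op_diff fun_times_monom)
    have "left_linear w"
      unfolding w_def by (rule left_linear_fun_times) (rule assms(1))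
    then have "u (X_mp 0) ** K = 0"
      using w [of "X_mp 0"] by (simp add: fun_deriv_def left_linear_zero)
    then have "K = 0"
      using invertible_moment_0 [OF assms(1,2)] invertible_mult_eq_0 by blast
    \<comment> \<open>\<open>w\<close> vanishes on all derivatives, and every polynomial is
      one.\<close>
    have "w P = 0" for P
      using ex_antiderivative [of P] w by (auto simp: \<open>K = 0\<close> fun_deriv_def)
    then have "scalar_mp \<alpha> \<star> mp_deriv y = 0"
      unfolding w_def by (rule fun_times_eq_0 [OF assms(2)])
    then have "mp_deriv y = 0"
      using \<alpha>(1) by (rule scalar_star_eq_0)
    then have "y = const_mp (coeff y 0)"
      by (rule mp_deriv_eq_0)
    \<comment> \<open>This coefficient is also \<open>- C\<close>, since \<open>x\<close> has degree
      at most \<open>k\<close>.\<close>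
    then have "coeff y (Suc k) = 0"
      by (metis coeff_monom nat.distinct(1))
    with x(1) C(1) show False
      by (simp add: y_def z_def coeff_eq_0)
  qed
qed

text \<open>Quasi-definiteness is carried along as existence of orthogonal polynomials, because
  derivatives of those for \<open>u\<close> supply those for the new functional at once.\<close>

lemma ex_orth_poly_fun_times_scalar_mp:
  assumes "left_linear u" "\<forall>n. \<exists>P. orth_poly u n P" "pearson u \<alpha> \<Psi>"
  shows "\<forall>n. \<exists>P. orth_poly (fun_times u (scalar_mp \<alpha>)) n P"
  using orth_poly_mp_deriv [OF assms(1,3)] invertible_M_mat [OF assms] assms(2) by blast

section \<open>Existence and uniqueness of orthogonal polynomials\<close>

lemma sum_div_mod:
  fixes f :: "nat \<Rightarrow> 'm::finite \<Rightarrow> 'b::comm_monoid_add"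
  shows "(\<Sum>r<(n + 1) * CARD('m). f (r div CARD('m)) (from_nat_into UNIV (r mod CARD('m))))
    = (\<Sum>i\<le>n. \<Sum>a\<in>UNIV. f i a)"
proof -
  let ?m = "CARD('m)" and ?e = "from_nat_into UNIV :: nat \<Rightarrow> 'm"
  have e: "bij_betw ?e {..<?m} UNIV"
    using bij_betw_from_nat_into_finite [of "UNIV :: 'm set"] by simp
  have "(\<Sum>i\<le>n. \<Sum>a\<in>UNIV. f i a) = (\<Sum>i<n + 1. \<Sum>s<?m. f i (?e s))"
    by (simp add: sum.reindex_bij_betw [OF e] lessThan_Suc_atMost)
  also have "\<dots> = (\<Sum>i<n + 1. \<Sum>r = i * ?m..<i * ?m + ?m. f (r div ?m) (?e (r mod ?m)))"
  proof (rule sum.cong [OF refl])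
    fix i
    show "(\<Sum>s<?m. f i (?e s)) = (\<Sum>r = i * ?m..<i * ?m + ?m. f (r div ?m) (?e (r mod ?m)))"
      by (rule sum.reindex_bij_witness [of _ "\<lambda>r. r - i * ?m" "\<lambda>s. i * ?m + s"])
        (auto simp: nat_less_iff div_nat_eqI mod_nat_eqI)
  qed
  also have "\<dots> = (\<Sum>r<(n + 1) * ?m. f (r div ?m) (?e (r mod ?m)))"
    by (rule sum.nat_group)
  finally show ?thesis ..
qed

lemma block_hankel_index:
  assumes "r < (n + 1) * CARD('m)" "c < (n + 1) * CARD('m)"
  shows "block_hankel (u :: 'm::finite mfunctional) n $$ (r, c)
    = moment u (r div CARD('m) + c div CARD('m))
        $ from_nat_into UNIV (r mod CARD('m)) $ from_nat_into UNIV (c mod CARD('m))"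
  using assms by (simp add: block_hankel_def Let_def)

text \<open>Translates block sums into scalar ones: row \<open>a\<close> of the matrices
  \<open>q i\<close>, concatenated, is a row vector multiplied by the Hankel matrix.\<close>

lemma block_hankel_row_product:
  fixes u :: "'m::finite mfunctional" and q :: "nat \<Rightarrow> 'm cmat"
  assumes "t < (n + 1) * CARD('m)"
  shows "(\<Sum>i\<le>n. q i ** moment u (i + t div CARD('m))) $ a $ from_nat_into UNIV (t mod CARD('m))
    = (\<Sum>r<(n + 1) * CARD('m). q (r div CARD('m)) $ a $ from_nat_into UNIV (r mod CARD('m))
        * block_hankel u n $$ (r, t))"
proof -
  have "(\<Sum>r<(n + 1) * CARD('m). q (r div CARD('m)) $ a $ from_nat_into UNIV (r mod CARD('m))
        * block_hankel u n $$ (r, t))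
      = (\<Sum>r<(n + 1) * CARD('m). q (r div CARD('m)) $ a $ from_nat_into UNIV (r mod CARD('m))
        * moment u (r div CARD('m) + t div CARD('m))
            $ from_nat_into UNIV (r mod CARD('m)) $ from_nat_into UNIV (t mod CARD('m)))"
    using assms by (intro sum.cong refl) (simp add: block_hankel_index del: mult_Suc)
  also have "\<dots> = (\<Sum>i\<le>n. \<Sum>b\<in>UNIV. q i $ a $ b
      * moment u (i + t div CARD('m)) $ b $ from_nat_into UNIV (t mod CARD('m)))"
    by (rule sum_div_mod)
  finally show ?thesis
    by (simp add: sum_component matrix_matrix_mult_def)
qed

text \<open>The inverse becomes a plain function, so that only finite sums occur later. The kernel
  argument uses one of the two identities, the solution of systems the other.\<close>

lemma block_hankel_inverse:
  assumes "Determinant.det (block_hankel (u :: 'm::finite mfunctional) n) \<noteq> 0"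
  shows "\<exists>B. \<forall>r<(n + 1) * CARD('m). \<forall>s<(n + 1) * CARD('m).
    (\<Sum>t<(n + 1) * CARD('m). block_hankel u n $$ (r, t) * B t s) = (if r = s then 1 else 0) \<and>
    (\<Sum>t<(n + 1) * CARD('m). B r t * block_hankel u n $$ (t, s)) = (if r = s then 1 else 0)"
proof -
  let ?N = "(n + 1) * CARD('m)" and ?H = "block_hankel u n"
  have H: "?H \<in> carrier_mat ?N ?N"
    by (simp add: block_hankel_def Let_def)
  from det_non_zero_imp_unit [OF H assms] obtain B where
    B: "B \<in> carrier_mat ?N ?N" "B * ?H = 1\<^sub>m ?N" "?H * B = 1\<^sub>m ?N"
    unfolding Units_def ring_mat_def by auto
  have *: "(\<Sum>t<?N. A $$ (r, t) * C $$ (t, s)) = (A * C) $$ (r, s)"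
    if "A \<in> carrier_mat ?N ?N" "C \<in> carrier_mat ?N ?N" "r < ?N" "s < ?N" for A C :: "complex mat" and r s
    using that by (simp add: scalar_prod_def atLeast0LessThan del: mult_Suc)
  show ?thesis
    by (intro exI [of _ "\<lambda>r s. B $$ (r, s)"] allI impI) (simp only: * H B index_one_mat)
qed

text \<open>Each concatenated row of \<open>q\<close> is a left kernel vector of an invertible
  matrix; multiplying by the inverse from the right gives 0.\<close>

lemma block_hankel_left_kernel:
  fixes u :: "'m::finite mfunctional" and q :: "nat \<Rightarrow> 'm cmat"
  assumes "Determinant.det (block_hankel u n) \<noteq> 0"
    and "\<And>k. k \<le> n \<Longrightarrow> (\<Sum>i\<le>n. q i ** moment u (i + k)) = 0" and "i \<le> n"
  shows "q i = 0"
proof -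
  define N where "N = (n + 1) * CARD('m)"
  let ?H = "block_hankel u n"
  let ?e = "from_nat_into UNIV :: nat \<Rightarrow> 'm"
  obtain B where B: "\<And>r s. r < N \<Longrightarrow> s < N \<Longrightarrow>
      (\<Sum>t<N. ?H $$ (r, t) * B t s) = (if r = s then 1 else 0)"
    using block_hankel_inverse [OF assms(1), folded N_def] by blast
  have zero: "q (s div CARD('m)) $ a $ ?e (s mod CARD('m)) = 0" if "s < N" for a s
  proof -
    let ?w = "\<lambda>r. q (r div CARD('m)) $ a $ ?e (r mod CARD('m))"
    have "?w s = (\<Sum>r<N. ?w r * (if r = s then 1 else 0))"
      using that by (simp add: if_distrib cong: if_cong)
    also have "\<dots> = (\<Sum>r<N. \<Sum>t<N. ?w r * ?H $$ (r, t) * B t s)"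
      using that by (intro sum.cong refl) (simp add: B mult.assoc flip: sum_distrib_left)
    also have "\<dots> = (\<Sum>t<N. (\<Sum>r<N. ?w r * ?H $$ (r, t)) * B t s)"
      by (subst sum.swap) (simp add: sum_distrib_right)
    also have "\<dots> = 0"
    proof (intro sum.neutral ballI)
      fix t assume t: "t \<in> {..<N}"
      then have "t div CARD('m) \<le> n"
        using less_mult_imp_div_less [of t "n + 1" "CARD('m)"] by (simp add: N_def)
      then show "(\<Sum>r<N. ?w r * ?H $$ (r, t)) * B t s = 0"
        using block_hankel_row_product [of t n q u a, folded N_def] t assms(2) by simp
    qed
    finally show ?thesis .
  qed
  have e: "bij_betw ?e {..<CARD('m)} UNIV"
    using bij_betw_from_nat_into_finite [of "UNIV :: 'm set"] by simp
  have "q i $ a $ b = 0" for a b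
  proof -
    obtain s where s: "s < CARD('m)" "b = ?e s"
      using e by (metis UNIV_I bij_betw_imp_surj_on imageE lessThan_iff)
    have "i * CARD('m) + s < N"
      using s(1) mult_le_mono1 [OF \<open>i \<le> n\<close>, of "CARD('m)"]
      unfolding N_def add_mult_distrib by linarith
    from zero [OF this, of a] s show ?thesis by simp
  qed
  then show ?thesis by (simp add: vec_eq_iff)
qed

lemma block_hankel_left_solve:
  fixes u :: "'m::finite mfunctional" and b :: "nat \<Rightarrow> 'm cmat"
  assumes "Determinant.det (block_hankel u n) \<noteq> 0"
  shows "\<exists>q. \<forall>k\<le>n. (\<Sum>i\<le>n. q i ** moment u (i + k)) = b k"
proof -
  define N where "N = (n + 1) * CARD('m)"
  let ?H = "block_hankel u n"
  let ?e = "from_nat_into UNIV :: nat \<Rightarrow> 'm"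
  obtain B where B: "\<And>r s. r < N \<Longrightarrow> s < N \<Longrightarrow>
      (\<Sum>t<N. B r t * ?H $$ (t, s)) = (if r = s then 1 else 0)"
    using block_hankel_inverse [OF assms(1), folded N_def] by blast
  have e: "bij_betw ?e {..<CARD('m)} UNIV"
    using bij_betw_from_nat_into_finite [of "UNIV :: 'm set"] by simp
  \<comment> \<open>\<open>d\<close> recovers the position of an index in the numbering
    \<open>?e\<close>.\<close>
  define d where "d = inv_into {..<CARD('m)} ?e"
  have d: "d a < CARD('m)" "?e (d a) = a" for a
    using bij_betw_inv_into_right [OF e, of a] bij_betwE [OF bij_betw_inv_into [OF e]]
    by (auto simp: d_def)
  have d': "d (?e s) = s" if "s < CARD('m)" for s
    using bij_betw_inv_into_left [OF e] that by (auto simp: d_def)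
  \<comment> \<open>The concatenated rows of \<open>b\<close> times the inverse, cut into blocks
    again.\<close>
  define q :: "nat \<Rightarrow> 'm cmat" where "q = (\<lambda>i. \<chi> a c. \<Sum>t<N. b (t div CARD('m)) $ a $ ?e (t mod CARD('m))
      * B t (i * CARD('m) + d c))"
  have "(\<Sum>i\<le>n. q i ** moment u (i + k)) $ a $ c = b k $ a $ c" if "k \<le> n" for k a c
  proof -
    define s where "s = k * CARD('m) + d c"
    have s: "s div CARD('m) = k" "?e (s mod CARD('m)) = c"
      using d [of c] by (auto simp: s_def)
    have "k * CARD('m) \<le> n * CARD('m)"
      using that by (rule mult_le_mono1)
    then have "s < N"
      using d(1) [of c] unfolding s_def N_def add_mult_distrib by linarith
    let ?w = "\<lambda>r. b (r div CARD('m)) $ a $ ?e (r mod CARD('m))"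
    have "(\<Sum>i\<le>n. q i ** moment u (i + k)) $ a $ c
        = (\<Sum>r<N. q (r div CARD('m)) $ a $ ?e (r mod CARD('m)) * ?H $$ (r, s))"
      using block_hankel_row_product [of s n q u a, folded N_def, OF \<open>s < N\<close>] unfolding s .
    also have "\<dots> = (\<Sum>r<N. \<Sum>t<N. ?w t * (B t r * ?H $$ (r, s)))"
      by (simp add: q_def d' sum_distrib_right mult.assoc)
    also have "\<dots> = (\<Sum>t<N. ?w t * (\<Sum>r<N. B t r * ?H $$ (r, s)))"
      by (subst sum.swap) (simp add: sum_distrib_left)
    also have "\<dots> = (\<Sum>t<N. ?w t * (if t = s then 1 else 0))"
      using \<open>s < N\<close> by (intro sum.cong refl) (simp add: B)
    also have "\<dots> = ?w s"
      using \<open>s < N\<close> by (simp add: if_distrib cong: if_cong)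
    finally show ?thesis by (simp add: s)
  qed
  then show ?thesis
    by (intro exI [of _ q]) (simp add: vec_eq_iff)
qed

section \<open>Orthogonal polynomials from the Hankel system\<close>

lemma left_linear_eq_moment_sum:
  assumes "left_linear u" "degree P \<le> N"
  shows "u (X_mp k \<star> P) = (\<Sum>i\<le>N. coeff P i ** moment u (i + k))"
proof -
  have "u (X_mp k \<star> P) = u (P \<star> X_mp k)"
    by (simp only: X_mp_star_commute)
  also have "\<dots> = (\<Sum>i\<le>N. coeff P i ** u (X_mp i \<star> X_mp k))"
    by (rule left_linear_star [OF assms])
  finally show ?thesis
    by (simp add: moment_def monom_star_monom)
qed

lemma not_invertible_imp_left_annihilator:
  fixes A :: "'m::finite cmat"
  assumes "\<not> invertible A"
  obtains C :: "'m cmat" where "C \<noteq> 0" "C ** A = 0"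
proof -
  have "\<not> invertible (transpose A)"
    using assms by (simp add: invertible_det_nz)
  then obtain C :: "'m cmat" where C: "C \<noteq> 0" "transpose A ** C = 0"
    by (rule not_invertible_imp_right_annihilator)
  have "transpose C ** A = transpose (transpose A ** C)"
    by (simp add: matrix_transpose_mul)
  also have "\<dots> = 0"
    by (simp only: C(2)) (simp add: transpose_def vec_eq_iff)
  finally show thesis
    using C(1) by (intro that [of "transpose C"]) (auto simp: transpose_def vec_eq_iff)
qed

text \<open>The lower coefficients solve the system of index \<open>n - 1\<close>. If \<langle>x^n
  P, u\<rangle> were singular, with left annihilator \<open>C\<close>, the coefficients of C P would
  lie in the left kernel of the Hankel matrix of index \<open>n\<close>, although the top one is
  \<open>C\<close>.\<close>

lemma ex_monic_orth_poly:
  fixes u :: "'m::finite mfunctional"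
  assumes "left_linear u" "quasi_definite u"
  shows "\<exists>P. orth_poly u n P \<and> lead_coeff P = mat 1"
proof -
  have det: "Determinant.det (block_hankel u k) \<noteq> 0" for k
    using assms(2) by (simp add: quasi_definite_def)
  \<comment> \<open>For \<open>n = 0\<close> there are no equations.\<close>
  have "\<exists>q. \<forall>k<n. (\<Sum>i<n. q i ** moment u (i + k)) = - moment u (n + k)"
    using block_hankel_left_solve [OF det, of "n - 1" "\<lambda>k. - moment u (n + k)"]
    by (cases n) (simp_all add: less_Suc_eq_le lessThan_Suc_atMost)
  then obtain q where
    q: "\<And>k. k < n \<Longrightarrow> (\<Sum>i<n. q i ** moment u (i + k)) = - moment u (n + k)"
    by blast
  define P where "P = (\<Sum>i<n. monom (q i) i) + X_mp n"
  have coeff: "coeff P j = (if j < n then q j else if j = n then mat 1 else 0)" for j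
    by (simp add: P_def coeff_sum)
  have mat_1: "mat 1 \<noteq> (0 :: 'm cmat)"
    by (intro invertible_imp_nonzero invertible_mat) simp
  have deg: "degree P = n"
    by (intro antisym degree_le le_degree) (simp_all add: coeff mat_1)
  have orth: "u (X_mp k \<star> P) = 0" if "k < n" for k
    using q [OF that]
    by (simp add: left_linear_eq_moment_sum [OF assms(1), of P n] deg coeff flip: lessThan_Suc_atMost)
  have "invertible (u (X_mp n \<star> P))"
  proof (rule ccontr)
    assume "\<not> invertible (u (X_mp n \<star> P))"
    then obtain C :: "'m cmat" where C: "C \<noteq> 0" "C ** u (X_mp n \<star> P) = 0"
      by (rule not_invertible_imp_left_annihilator)
    have "(\<Sum>i\<le>n. C ** coeff P i ** moment u (i + k)) = 0" if "k \<le> n" for k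
    proof -
      have "(\<Sum>i\<le>n. C ** coeff P i ** moment u (i + k)) = C ** u (X_mp k \<star> P)"
        by (simp add: left_linear_eq_moment_sum [OF assms(1) eq_imp_le [OF deg]] matrix_mult_sum
            matrix_mul_assoc)
      with that orth C(2) show ?thesis
        by (cases "k = n") simp_all
    qed
    from block_hankel_left_kernel [OF det this, of n] C(1) show False
      by (simp add: coeff)
  qed
  moreover have "invertible (mat 1 :: 'm cmat)"
    by (rule invertible_mat) simp
  ultimately show ?thesis
    using deg orth by (intro exI [of _ P]) (simp add: orth_poly_def coeff)
qed

text \<open>The difference has no terms of degree \<open>n\<close> or more and is orthogonal to all
  lower powers, so its coefficients lie in the left kernel of the Hankel matrix of index
  \<open>n - 1\<close>.\<close>

lemma orth_poly_unique:
  fixes u :: "'m::finite mfunctional"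
  assumes "left_linear u" "quasi_definite u" "orth_poly u n P" "orth_poly u n Q"
    and "lead_coeff P = lead_coeff Q"
  shows "P = Q"
proof -
  have deg: "degree P = n" "degree Q = n"
    and orth: "\<And>k. k < n \<Longrightarrow> u (X_mp k \<star> (P - Q)) = 0"
    using assms(3,4) by (auto simp: orth_poly_def star_distribs left_linear_diff [OF assms(1)])
  have high: "coeff (P - Q) i = 0" if "i \<ge> n" for i
    using assms(5) that deg by (cases "i = n") (simp_all add: coeff_eq_0)
  have "coeff (P - Q) i = 0" if "i < n" for i
  proof (rule block_hankel_left_kernel)
    show "Determinant.det (block_hankel u (n - 1)) \<noteq> 0"
      using assms(2) by (simp add: quasi_definite_def)
    show "i \<le> n - 1"
      using that by simp
    fix k assume "k \<le> n - 1"
    with that have "k < n" by simp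
    moreover have "degree (P - Q) \<le> n - 1"
      by (intro degree_le allI impI high) (use that in arith)
    ultimately show "(\<Sum>i\<le>n - 1. coeff (P - Q) i ** moment u (i + k)) = 0"
      using orth [of k] left_linear_eq_moment_sum [OF assms(1), of "P - Q" "n - 1" k] by simp
  qed
  with high have "P - Q = 0"
    by (intro poly_eqI) (metis coeff_0 not_less)
  then show ?thesis by simp
qed

section \<open>The differential equation\<close>

lemma matrix_mult_eq_mat_commute:
  fixes A B :: "'m::finite cmat"
  assumes "A ** B = mat c" "c \<noteq> 0"
  shows "B ** A = mat c"
proof -
  have "(mat (1 / c) ** A) ** B = mat 1"
    using assms by (simp flip: matrix_mul_assoc mat_mult)
  then have "B ** (mat (1 / c) ** A) = mat 1"
    by (simp add: matrix_left_right_inverse)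
  then have "mat c ** (mat (1 / c) ** (B ** A)) = mat c ** mat 1"
    by (simp only: mat_left_commute)
  then show ?thesis
    using assms(2) by (simp add: matrix_mul_assoc flip: mat_mult)
qed

lemma mat_mult_left_cancel:
  assumes "mat c ** A = mat c ** B" "c \<noteq> 0"
  shows "A = (B :: 'm::finite cmat)"
  using assms by (simp add: vec_eq_iff mat_mult_nth)

text \<open>
  With \<open>t = \<mu>\<^sub>0 \<psi>\<^sub>1\<close> and \<open>r = \<mu>\<^sub>0 \<psi>\<^sub>0 t\<^sup>-\<^sup>1\<close>, orthogonality to constants reads \<open>q\<^sub>0 = q\<^sub>1 r\<close>, and
  the normalization becomes \<open>q\<^sub>1 (-\<alpha>(-r)) t = c I\<close>. Hence \<open>t q\<^sub>1\<close> is a multiple of the inverse of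
  a polynomial in \<open>r\<close>, so it commutes with \<open>r\<close>.
\<close>

lemma degree_1_commutation:
  fixes \<mu>0 :: "'m::finite cmat"
  assumes inv: "invertible \<mu>0" "invertible \<psi>1" and "c \<noteq> 0"
    and pearson_0: "\<mu>0 ** \<psi>0 + \<mu>1 ** \<psi>1 = 0"
    and pearson_1: "mat a0 ** \<mu>0 + mat a1 ** \<mu>1 + mat a2 ** \<mu>2 = - (\<mu>1 ** \<psi>0 + \<mu>2 ** \<psi>1)"
    and orth: "q0 ** \<mu>0 + q1 ** \<mu>1 = 0"
    and norm: "(q0 ** \<mu>1 + q1 ** \<mu>2) ** (\<psi>1 ** (\<psi>1 + mat a2)) = mat c"
  shows "\<psi>0 ** q1 = \<psi>1 ** q0"
proof -
  define t where "t = \<mu>0 ** \<psi>1"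
  define s where "s = \<mu>0 ** \<psi>0"
  have "invertible t"
    unfolding t_def by (rule invertible_mult [OF inv])
  define r where "r = s ** matrix_inv t"
  have s: "s = r ** t"
    using matrix_inv_mult(2) [OF \<open>invertible t\<close>] by (simp add: r_def flip: matrix_mul_assoc)
  have \<mu>1: "\<mu>1 ** \<psi>1 = - s"
    using pearson_0 by (simp add: s_def eq_neg_iff_add_eq_0 add.commute)
  have q0_\<mu>0: "q0 ** \<mu>0 = - (q1 ** \<mu>1)"
    using orth by (simp add: eq_neg_iff_add_eq_0)
  have "q0 ** t = - (q1 ** (\<mu>1 ** \<psi>1))"
    by (simp add: t_def q0_\<mu>0 matrix_mul_assoc)
  then have "(q0 - q1 ** r) ** t = 0"
    by (simp add: \<mu>1 s matrix_diff_distrib matrix_mul_assoc)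
  then have q0: "q0 = q1 ** r"
    using mult_invertible_eq_0 [OF \<open>invertible t\<close>] by fastforce
  define A where "A = mat a1 ** r - mat a0 - mat a2 ** (r ** r)"
  \<comment> \<open>The factor \<open>\<psi>1 + mat a2\<close> of the normalization is just what
    allows \<open>\<mu>2\<close> to be eliminated.\<close>
  have "\<mu>2 ** \<psi>1 + mat a2 ** \<mu>2 = - (\<mu>1 ** \<psi>0) - mat a0 ** \<mu>0 - mat a1 ** \<mu>1"
    using pearson_1 by (simp add: algebra_simps)
  then have q1_\<mu>2: "q1 ** (\<mu>2 ** (\<psi>1 + mat a2))
      = q0 ** s - mat a0 ** (q1 ** \<mu>0) - mat a1 ** (q1 ** \<mu>1)"
    by (simp add: matrix_add_ldistrib matrix_diff_distrib mat_left_commute [of q1] s_def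
        matrix_mul_assoc q0_\<mu>0 flip: mat_mult_commute)
  have "q0 ** (\<mu>1 ** (\<psi>1 + mat a2)) = - (q0 ** s) + mat a2 ** (q0 ** \<mu>1)"
    by (simp add: matrix_add_ldistrib matrix_diff_distrib \<mu>1 mat_left_commute [of q0] flip: mat_mult_commute)
  with q1_\<mu>2 have "(q0 ** \<mu>1 + q1 ** \<mu>2) ** (\<psi>1 + mat a2)
      = mat a2 ** (q0 ** \<mu>1) - mat a0 ** (q1 ** \<mu>0) - mat a1 ** (q1 ** \<mu>1)"
    by (simp add: matrix_add_rdistrib flip: matrix_mul_assoc)
  then have "(q0 ** \<mu>1 + q1 ** \<mu>2) ** (\<psi>1 + mat a2) ** \<psi>1
      = mat a2 ** (q0 ** (\<mu>1 ** \<psi>1)) - mat a0 ** (q1 ** t) - mat a1 ** (q1 ** (\<mu>1 ** \<psi>1))"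
    by (simp add: matrix_diff_distrib t_def flip: matrix_mul_assoc)
  also have "\<dots> = q1 ** (A ** t)"
    by (simp add: \<mu>1 s q0 A_def matrix_diff_distrib mat_left_commute [of q1] mat_left_commute [of r]
        flip: matrix_mul_assoc)
  also have "(q0 ** \<mu>1 + q1 ** \<mu>2) ** (\<psi>1 + mat a2) ** \<psi>1 = mat c"
    unfolding norm [symmetric]
    by (simp add: matrix_add_ldistrib matrix_add_rdistrib mat_mult_commute flip: matrix_mul_assoc)
  finally have q1: "q1 ** (A ** t) = mat c" ..
  define X where "X = t ** q1"
  have AX: "A ** X = mat c"
    using matrix_mult_eq_mat_commute [OF q1 \<open>c \<noteq> 0\<close>] by (simp add: X_def matrix_mul_assoc)
  have XA: "X ** A = mat c"
    by (rule matrix_mult_eq_mat_commute [OF AX \<open>c \<noteq> 0\<close>])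
  have Ar: "A ** r = r ** A"
    by (simp add: A_def matrix_diff_distrib mat_left_commute [of r] mat_mult_commute [of a0]
        flip: matrix_mul_assoc)
  \<comment> \<open>\<open>A r = r A\<close> is multiplied by \<open>X\<close> from both sides,
    \<open>X\<close> being the inverse of \<open>A\<close> up to the scalar
    \<open>c\<close>.\<close>
  have "mat c ** (r ** X) = X ** (A ** r) ** X"
    by (simp add: XA matrix_mul_assoc)
  also have "\<dots> = X ** r ** (A ** X)"
    by (simp only: Ar matrix_mul_assoc)
  also have "\<dots> = mat c ** (X ** r)"
    by (simp add: AX mat_mult_commute)
  finally have "r ** X = X ** r"
    using \<open>c \<noteq> 0\<close> by (rule mat_mult_left_cancel)
  moreover have "\<mu>0 ** (\<psi>0 ** q1) = r ** X"
    using s by (simp add: s_def X_def matrix_mul_assoc)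
  moreover have "\<mu>0 ** (\<psi>1 ** q0) = X ** r"
    by (simp add: q0 X_def t_def matrix_mul_assoc)
  ultimately have "\<mu>0 ** (\<psi>0 ** q1 - \<psi>1 ** q0) = 0"
    by (simp add: matrix_diff_distrib)
  then show ?thesis
    using invertible_mult_eq_0 [OF inv(1)] by fastforce
qed

section \<open>The differential equation for normalized orthogonal polynomials\<close>

lemma ode_solution_iff:
  "ode_solution \<alpha> \<Psi> n y \<longleftrightarrow>
    pearson_op \<alpha> \<Psi> y - const_mp (real n *\<^sub>R M_mat \<alpha> \<Psi> (int n - 1)) \<star> y = 0"
  by (simp add: ode_solution_def pearson_op_def)

text \<open>Here y'' = 0 and M_0 = \<psi>_1, so the terms in x cancel and the constant term is the
  commutation relation. The normalization enters through V_0 = \<psi>_1 (\<psi>_1 + \<alpha>_2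
  I).\<close>

lemma ode_solution_degree_1:
  fixes u :: "'m::finite mfunctional"
  assumes "left_linear u" "\<forall>n. \<exists>P. orth_poly u n P" "pearson u \<alpha> \<Psi>"
    and "degree Q \<le> 1" "u Q = 0" "u (X_mp 1 \<star> Q) ** V_mat \<alpha> \<Psi> 0 = mat c" "c \<noteq> 0"
  shows "ode_solution \<alpha> \<Psi> 1 Q"
proof -
  note \<alpha> = pearsonD [OF assms(3)]
  define \<mu> where "\<mu> k = u (X_mp k)" for k
  define q where "q = coeff Q"
  have Q: "Q = const_mp (q 0) + monom (q 1) 1"
    using poly_as_sum_of_monoms' [OF assms(4)] by (simp add: q_def)
  have u_monom: "u (X_mp k \<star> monom A j) = A ** \<mu> (k + j)" for A k j
    using left_linear_monom_star [OF assms(1), of A j "X_mp k"]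
    by (simp add: X_mp_star_commute monom_star_monom \<mu>_def add.commute)
  have "\<psi> 0 ** q 1 = \<psi> 1 ** q 0" if "\<psi> = coeff \<Psi>" for \<psi>
  proof (rule degree_1_commutation [where c = c])
    show "invertible (\<mu> 0)"
      unfolding \<mu>_def by (rule invertible_moment_0 [OF assms(1,2)])
    show "invertible (\<psi> 1)"
      using invertible_M_mat [OF assms(1-3), of 0] by (simp add: M_mat_def that)
    show "\<mu> 0 ** \<psi> 0 + \<mu> 1 ** \<psi> 1 = 0"
      using pearson_apply [OF assms(1,3), of "X_mp 0"] that
      by (simp add: left_linear_zero [OF assms(1)] \<mu>_def neg_eq_iff_add_eq_0)
    have "mp_deriv (X_mp 1) = (X_mp 0 :: 'm mpoly)"
      by (simp add: mp_deriv_X_mp)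
    then show "mat (coeff \<alpha> 0) ** \<mu> 0 + mat (coeff \<alpha> 1) ** \<mu> 1 + mat (coeff \<alpha> 2) ** \<mu> 2
        = - (\<mu> 1 ** \<psi> 0 + \<mu> 2 ** \<psi> 1)"
      using pearson_apply [OF assms(1,3), of "X_mp 1"]
        fun_times_scalar_mp_quadratic [OF \<alpha>(2), of u "X_mp 0"]
      by (simp add: fun_times_scalar_mp [OF assms(1)] monom_star_monom \<mu>_def numeral_2_eq_2 that)
    show "q 0 ** \<mu> 0 + q 1 ** \<mu> 1 = 0"
      using assms(5) u_monom [of 0] by (simp add: Q left_linear_add [OF assms(1)])
    have "u (X_mp 1 \<star> Q) = q 0 ** \<mu> 1 + q 1 ** \<mu> 2"
      by (simp add: Q star_distribs left_linear_add [OF assms(1)] u_monom numeral_2_eq_2)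
    moreover have "V_mat \<alpha> \<Psi> 0 = \<psi> 1 ** (\<psi> 1 + mat (coeff \<alpha> 2))"
      by (simp add: V_mat_def M_mat_def upto.simps that)
    ultimately show "(q 0 ** \<mu> 1 + q 1 ** \<mu> 2) ** (\<psi> 1 ** (\<psi> 1 + mat (coeff \<alpha> 2))) = mat c"
      using assms(6) by simp
  qed (fact assms(7))
  then have commute: "coeff \<Psi> 0 ** q 1 = coeff \<Psi> 1 ** q 0"
    by blast
  have "mp_deriv Q = const_mp (q 1)"
    by (rule poly_eqI) (auto simp: Q coeff_mp_deriv)
  then have op: "pearson_op \<alpha> \<Psi> Q = \<Psi> \<star> const_mp (q 1)"
    by (simp add: pearson_op_def)
  show ?thesis
    unfolding ode_solution_iff op
  proof (rule poly_eqI)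
    fix k :: nat
    consider "k = 0" | "k = 1" | "k > 1" by linarith
    then show "coeff (\<Psi> \<star> const_mp (q 1) - const_mp (real 1 *\<^sub>R M_mat \<alpha> \<Psi> (int 1 - 1)) \<star> Q) k
        = coeff 0 k"
      by cases (use \<alpha>(3) commute in \<open>auto simp: coeff_star_const coeff_monom_star M_mat_def Q
          coeff_eq_0\<close>)
  qed
qed

text \<open>Differentiating \<Psi>Q' yields an extra \<psi>_1 Q', and (n+1)M_n = \<psi>_1 + n
  M_(n+1) absorbs it. For the new equation M_(n+1) has index n-1.\<close>

lemma mp_deriv_ode:
  fixes \<Psi> Q :: "'m::finite mpoly"
  assumes "degree \<Psi> \<le> 1"
  shows "mp_deriv (pearson_op \<alpha> \<Psi> Q
      - const_mp (real (Suc n) *\<^sub>R M_mat \<alpha> \<Psi> (int n)) \<star> Q)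
    = pearson_op \<alpha> (\<Psi> + scalar_mp (pderiv \<alpha>)) (mp_deriv Q)
      - const_mp (real n *\<^sub>R M_mat \<alpha> (\<Psi> + scalar_mp (pderiv \<alpha>)) (int n - 1)) \<star> mp_deriv Q"
proof -
  have "mp_deriv \<Psi> = const_mp (coeff \<Psi> 1)"
    using assms by (intro poly_eqI) (auto simp: coeff_mp_deriv coeff_eq_0)
  moreover have "const_mp (real (Suc n) *\<^sub>R M_mat \<alpha> \<Psi> (int n))
      = const_mp (coeff \<Psi> 1)
        + const_mp (real n *\<^sub>R M_mat \<alpha> (\<Psi> + scalar_mp (pderiv \<alpha>)) (int n - 1))"
  proof -
    have "M_mat \<alpha> (\<Psi> + scalar_mp (pderiv \<alpha>)) (int n - 1) = M_mat \<alpha> \<Psi> (int n + 1)"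
      by (simp add: M_mat_shift add.commute)
    moreover have "real (Suc n) *\<^sub>R M_mat \<alpha> \<Psi> (int n)
        = coeff \<Psi> 1 + real n *\<^sub>R M_mat \<alpha> \<Psi> (int n + 1)"
      unfolding scaleR_eq_mat_mult M_mat_def vec_eq_iff vector_add_component mat_mult_nth
      by (simp add: mat_def algebra_simps)
    ultimately show ?thesis
      by (simp only: add_monom)
  qed
  ultimately show ?thesis
    by (simp add: pearson_op_def mp_deriv_add mp_deriv_diff mp_deriv_star mp_deriv_scalar_mp
        star_distribs algebra_simps)
qed

text \<open>The constant \<open>c\<close> is free because each differentiation changes the sign of
  the normalization. The induction starts in degree 1, since the step uses \<langle>Q', v\<rangle> =
  0.\<close>

lemma ode_solution_of_normalized:
  fixes u :: "'m::finite mfunctional"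
  assumes "left_linear u" "\<forall>n. \<exists>P. orth_poly u n P" "pearson u \<alpha> \<Psi>"
    and "degree Q \<le> Suc m" "\<And>k. k < Suc m \<Longrightarrow> u (X_mp k \<star> Q) = 0"
    and "u (X_mp (Suc m) \<star> Q) ** V_mat \<alpha> \<Psi> (int m) = mat c" "c \<noteq> 0"
  shows "ode_solution \<alpha> \<Psi> (Suc m) Q"
  using assms
proof (induction m arbitrary: u \<Psi> Q c)
  case 0
  then show ?case
    using ode_solution_degree_1 [of u \<alpha> \<Psi> Q c] by fastforce
next
  case (Suc m)
  note lin = Suc.prems(1) and pearson = Suc.prems(3) and orth = Suc.prems(5)
  note \<alpha> = pearsonD [OF pearson]
  define v where "v = fun_times u (scalar_mp \<alpha>)"
  define \<Phi> where "\<Phi> = \<Psi> + scalar_mp (pderiv \<alpha>)"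
  define G where "G = u (X_mp (Suc (Suc m)) \<star> Q)"
  let ?M = "M_mat \<alpha> \<Psi> (int (Suc m))"
  have v_lin: "left_linear v"
    unfolding v_def by (rule left_linear_fun_times [OF lin])
  have v_pearson: "pearson v \<alpha> \<Phi>"
    unfolding v_def \<Phi>_def by (rule pearson_fun_times [OF lin pearson])
  have v_ops: "\<forall>n. \<exists>P. orth_poly v n P"
    unfolding v_def by (rule ex_orth_poly_fun_times_scalar_mp [OF Suc.prems(1-3)])
  have v_orth: "v (X_mp k \<star> mp_deriv Q) = 0" if "k < Suc m" for k
    unfolding v_def by (rule orthogonal_mp_deriv(1) [OF lin pearson orth that])
  have v_norm: "v (X_mp (Suc m) \<star> mp_deriv Q) = - (G ** ?M)"
    unfolding v_def G_def by (rule orthogonal_mp_deriv(2) [OF lin pearson orth])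
  have GV: "G ** V_mat \<alpha> \<Psi> (int (Suc m)) = mat c"
    using Suc.prems(6) by (simp add: G_def)
  have "ode_solution \<alpha> \<Phi> (Suc m) (mp_deriv Q)"
  proof (rule Suc.IH [OF v_lin v_ops v_pearson])
    show "degree (mp_deriv Q) \<le> Suc m"
      using Suc.prems(4) by (intro degree_le) (auto simp: coeff_mp_deriv coeff_eq_0)
    have "V_mat \<alpha> \<Psi> (int (Suc m)) = ?M ** V_mat \<alpha> \<Phi> (int m)"
      using V_mat_shift [of "int (Suc m)" \<alpha> \<Psi>] by (simp add: \<Phi>_def)
    moreover have "mat (- c) = - (mat c :: 'm cmat)"
      by (simp add: vec_eq_iff mat_def)
    ultimately show "v (X_mp (Suc m) \<star> mp_deriv Q) ** V_mat \<alpha> \<Phi> (int m) = mat (- c)"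
      unfolding v_norm using GV by (simp flip: matrix_mul_assoc)
  qed (use v_orth \<open>c \<noteq> 0\<close> in auto)
  define R where "R = pearson_op \<alpha> \<Psi> Q
      - const_mp (real (Suc (Suc m)) *\<^sub>R M_mat \<alpha> \<Psi> (int (Suc m))) \<star> Q"
  have "mp_deriv R = 0"
    using \<open>ode_solution \<alpha> \<Phi> (Suc m) (mp_deriv Q)\<close>
    unfolding R_def mp_deriv_ode [OF \<alpha>(3)] ode_solution_iff \<Phi>_def .
  then obtain K where K: "R = const_mp K \<star> X_mp 0"
    using mp_deriv_eq_0 by (metis star_X_mp_0)
  \<comment> \<open>Only \<langle>xQ', v\<rangle> and \<langle>x^2 Q, u\<rangle> remain. Both vanish
    for \<open>m > 0\<close>; for \<open>m = 0\<close>, that is degree 2, they cancel by commutation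
    with \<psi>_1.\<close>
  have "v R = 0"
  proof -
    let ?d = "v (X_mp 1 \<star> mp_deriv Q)" and ?a = "mat (coeff \<alpha> 2) :: 'm cmat"
    have "v (mp_deriv Q) = 0"
      using v_orth [of 0] by simp
    then have "v (pearson_op \<alpha> \<Psi> Q) = - (?d ** coeff \<Phi> 1) + coeff \<Psi> 1 ** ?d"
      by (simp add: pearson_op_def left_linear_add [OF v_lin] pearson_apply [OF v_lin v_pearson]
          left_linear_star [OF v_lin \<alpha>(3)])
    moreover have "v Q = ?a ** u (X_mp 2 \<star> Q)"
      unfolding v_def fun_times_scalar_mp_quadratic [OF \<alpha>(2)] using orth [of 0] orth [of 1] by simp
    ultimately have vR: "v R = - (?d ** coeff \<Phi> 1) + coeff \<Psi> 1 ** ?d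
        - real (Suc (Suc m)) *\<^sub>R (?M ** (?a ** u (X_mp 2 \<star> Q)))"
      by (simp add: R_def left_linear_diff [OF v_lin] left_linear_const_star [OF v_lin]
          matrix_scaleR_mult del: of_nat_Suc)
    show ?thesis
    proof (cases "m = 0")
      case False
      then show ?thesis
        using v_orth [of 1] orth [of 2] by (simp add: vR)
    next
      case True
      \<comment> \<open>\<open>G\<close> is \<open>c\<close> times the inverse of a matrix that
        commutes with \<psi>_1, so it commutes with \<psi>_1 as well.\<close>
      have "invertible (V_mat \<alpha> \<Psi> (int (Suc m)))"
      proof (rule invertible_V_mat)
        fix i assume "int (Suc m) \<le> i"
        then show "invertible (M_mat \<alpha> \<Psi> i)"
          using invertible_M_mat [OF Suc.prems(1-3), of "nat i"] by simp
      qed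
      moreover have "G ** coeff \<Psi> 1 ** V_mat \<alpha> \<Psi> (int (Suc m))
          = G ** V_mat \<alpha> \<Psi> (int (Suc m)) ** coeff \<Psi> 1"
        by (simp only: V_mat_commute flip: matrix_mul_assoc)
      then have "(G ** coeff \<Psi> 1 - coeff \<Psi> 1 ** G) ** V_mat \<alpha> \<Psi> (int (Suc m)) = 0"
        by (simp only: GV mat_mult_commute matrix_diff_distrib flip: matrix_mul_assoc) simp
      ultimately have G: "G ** coeff \<Psi> 1 = coeff \<Psi> 1 ** G"
        using mult_invertible_eq_0 by fastforce
      define X where "X = G ** ?M"
      have "X = ?M ** G"
        using G by (simp add: X_def M_mat_def matrix_add_ldistrib matrix_add_rdistrib mat_mult_commute)
      then have MaG: "?M ** (?a ** G) = ?a ** X"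
        by (simp only: mat_left_commute)
      have "coeff \<Psi> 1 ** X = X ** coeff \<Psi> 1"
        unfolding X_def
        by (simp only: matrix_mul_assoc G [symmetric]) (simp only: M_mat_commute flip: matrix_mul_assoc)
      moreover have "X ** mat (2 * coeff \<alpha> 2) = 2 *\<^sub>R (?a ** X)"
        unfolding mat_mult_commute [of "2 * coeff \<alpha> 2" X, symmetric] scaleR_eq_mat_mult
        by (simp add: vec_eq_iff mat_mult_nth)
      moreover have "coeff \<Phi> 1 = coeff \<Psi> 1 + mat (2 * coeff \<alpha> 2)"
        by (simp add: \<Phi>_def coeff_scalar_mp coeff_pderiv numeral_2_eq_2)
      moreover have "?d = - X" "u (X_mp 2 \<star> Q) = G"
        using v_norm True by (simp_all add: G_def X_def numeral_2_eq_2)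
      moreover have "real (Suc (Suc m)) = 2"
        using True by simp
      ultimately show ?thesis
        unfolding vR by (simp only: MaG matrix_add_ldistrib matrix_minus_mult) simp
    qed
  qed
  then have "K ** v (X_mp 0) = 0"
    unfolding K left_linear_const_star [OF v_lin] .
  then have "K = 0"
    using invertible_moment_0 [OF v_lin v_ops] mult_invertible_eq_0 by blast
  then have "R = 0"
    by (simp add: K)
  then show ?case
    by (simp add: ode_solution_iff R_def)
qed

section \<open>Uniqueness of the solution\<close>

lemma mp_deriv_star_const: "mp_deriv (y \<star> const_mp C) = mp_deriv y \<star> const_mp C"
  by (simp add: mp_deriv_star)

lemma unique_ode_solution:
  fixes y :: "'m::finite mpoly"
  assumes "degree \<alpha> \<le> 2" "degree \<Psi> \<le> 1" "\<And>k. invertible (M_mat \<alpha> \<Psi> (int k))"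
    and "invertible (coeff y n)" "ode_solution \<alpha> \<Psi> n y"
  shows "unique_up_to_right_factors (ode_solution \<alpha> \<Psi> n) y"
  unfolding unique_up_to_right_factors_def
proof (intro conjI allI iffI)
  show "y \<noteq> 0"
    using invertible_imp_nonzero [OF assms(4)] by auto
  let ?B = "real n *\<^sub>R M_mat \<alpha> \<Psi> (int n - 1)"
  have right_mult: "ode_solution \<alpha> \<Psi> n (y \<star> const_mp C)" for C
  proof -
    have "pearson_op \<alpha> \<Psi> (y \<star> const_mp C) - const_mp ?B \<star> (y \<star> const_mp C)
        = (pearson_op \<alpha> \<Psi> y - const_mp ?B \<star> y) \<star> const_mp C"
      by (simp add: pearson_op_def mp_deriv_star_const star_distribs star_assoc)
    with assms(5) show ?thesis
      by (simp add: ode_solution_iff)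
  qed
  fix z
  show "ode_solution \<alpha> \<Psi> n z" if "\<exists>C. z = y \<star> const_mp C"
    using that right_mult by blast
  show "\<exists>C. z = y \<star> const_mp C" if z: "ode_solution \<alpha> \<Psi> n z"
  proof
    \<comment> \<open>Chosen so that the coefficient of x^n in \<open>w\<close> vanishes, which
      excludes degree \<open>n\<close>.\<close>
    define C where "C = matrix_inv (coeff y n) ** coeff z n"
    define w where "w = z - y \<star> const_mp C"
    have w_n: "coeff w n = 0"
      by (simp add: w_def C_def coeff_star_const matrix_mul_assoc matrix_inv_mult [OF assms(4)])
    have ode: "pearson_op \<alpha> \<Psi> w = const_mp ?B \<star> w"
      using z right_mult [of C] by (simp add: w_def ode_solution_iff pearson_op_diff star_distribs)
    show "z = y \<star> const_mp C"
    proof (rule ccontr)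
      assume "z \<noteq> y \<star> const_mp C"
      then have "w \<noteq> 0" by (simp add: w_def)
      define d where "d = degree w"
      have w_d: "coeff w d \<noteq> 0"
        using \<open>w \<noteq> 0\<close> by (simp add: d_def)
      then have "d \<noteq> n"
        using w_n by auto
      have top: "real d *\<^sub>R (M_mat \<alpha> \<Psi> (int d - 1) ** coeff w d) = ?B ** coeff w d"
        using coeff_pearson_op [OF assms(1,2), of d w] unfolding ode
        by (simp add: coeff_monom_star coeff_eq_0 d_def)
      \<comment> \<open>The identity d M_(d-1) - n M_(n-1) = (d-n) M_(d+n-1); its last index is
        non-negative because \<open>d \<noteq> n\<close>.\<close>
      have "mat (of_real (real d - real n)) ** M_mat \<alpha> \<Psi> (int d + int n - 1)
          = real d *\<^sub>R M_mat \<alpha> \<Psi> (int d - 1) - ?B"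
        unfolding scaleR_eq_mat_mult M_mat_def vec_eq_iff vector_add_component
          vector_minus_component mat_mult_nth
        by (simp add: mat_def algebra_simps)
      then have "mat (of_real (real d - real n)) ** (M_mat \<alpha> \<Psi> (int d + int n - 1) ** coeff w d)
          = (real d *\<^sub>R M_mat \<alpha> \<Psi> (int d - 1) - ?B) ** coeff w d"
        by (simp only: matrix_mul_assoc)
      also have "\<dots> = 0"
        unfolding matrix_diff_distrib(1) top [symmetric] by (simp add: matrix_scaleR_mult)
      finally have "mat (of_real (real d - real n))
          ** (M_mat \<alpha> \<Psi> (int d + int n - 1) ** coeff w d) = 0" .
      moreover have "invertible (mat (of_real (real d - real n)) :: 'm cmat)"
        using \<open>d \<noteq> n\<close> by (intro invertible_mat) simp
      moreover have "invertible (M_mat \<alpha> \<Psi> (int d + int n - 1))"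
        using assms(3) [of "d + n - 1"] \<open>d \<noteq> n\<close> by (simp add: of_nat_diff)
      ultimately show False
        using w_d invertible_mult_eq_0 by blast
    qed
  qed
qed

section \<open>The orthogonal polynomial with leading coefficient \<open>kappa\<close>\<close>

lemma orth_poly_const_star:
  assumes "left_linear u" "orth_poly u n P" "invertible A"
  shows "orth_poly u n (const_mp A \<star> P)" "lead_coeff (const_mp A \<star> P) = A ** lead_coeff P"
proof -
  have P: "degree P = n" "invertible (coeff P n)" "\<forall>k<n. u (X_mp k \<star> P) = 0"
    "invertible (u (X_mp n \<star> P))"
    using assms(2) by (auto simp: orth_poly_def)
  have inv: "invertible (A ** coeff P n)"
    by (rule invertible_mult [OF assms(3) P(2)])
  have deg: "degree (const_mp A \<star> P) = n"
    using invertible_imp_nonzero [OF inv]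
    by (intro antisym degree_le le_degree) (auto simp: coeff_monom_star coeff_eq_0 P(1))
  then show "lead_coeff (const_mp A \<star> P) = A ** lead_coeff P"
    by (simp add: coeff_monom_star P(1))
  have "u (X_mp k \<star> (const_mp A \<star> P)) = A ** u (X_mp k \<star> P)" for k
    by (simp only: X_mp_star_left_commute [symmetric] left_linear_const_star [OF assms(1)])
  then show "orth_poly u n (const_mp A \<star> P)"
    using inv deg P by (simp add: orth_poly_def coeff_monom_star invertible_mult assms(3))
qed

lemma monic_orth_poly:
  assumes "left_linear u" "quasi_definite u"
  shows "orth_poly u n (monic_orth_poly u n)" "lead_coeff (monic_orth_poly u n) = mat 1"
proof -
  have "\<exists>!P. orth_poly u n P \<and> lead_coeff P = mat 1"
    using ex_monic_orth_poly [OF assms] orth_poly_unique [OF assms] by metis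
  from theI' [OF this] show "orth_poly u n (monic_orth_poly u n)"
    "lead_coeff (monic_orth_poly u n) = mat 1"
    by (auto simp: monic_orth_poly_def)
qed

text \<open>For \<open>n = 0\<close> every non-singular constant is an orthogonal solution, even if
  M_(-1) is singular, so the first conjunct is unconditional. For \<open>n \<ge> 1\<close> the
  polynomial with leading coefficient \<open>kappa\<close> satisfies the normalization and serves as
  \<open>y\<close>.\<close>

theorem theorem4p4:
  fixes u :: "'m::finite mfunctional" and \<alpha> :: "complex poly" and \<Psi> :: "'m mpoly" and n :: nat
  assumes "zero_class_functional u" and "pearson u \<alpha> \<Psi>"
  shows "(\<exists>y. unique_up_to_right_factors (ode_solution \<alpha> \<Psi> n) y \<and> orth_poly u n y) \<and>
    (n \<ge> 1 \<or> invertible (M_mat \<alpha> \<Psi> (-1)) \<longrightarrow>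
      invertible (E_mat u n ** V_mat \<alpha> \<Psi> (int n - 1)) \<and>
      (\<exists>!Q. orth_poly u n Q \<and> lead_coeff Q = kappa u \<alpha> \<Psi> n) \<and>
      (\<forall>Q. orth_poly u n Q \<and> lead_coeff Q = kappa u \<alpha> \<Psi> n \<longrightarrow>
         unique_up_to_right_factors (ode_solution \<alpha> \<Psi> n) Q))"
proof -
  have lin: "left_linear u" and qd: "quasi_definite u"
    using assms(1) by (auto simp: zero_class_functional_def)
  have ops: "\<forall>n. \<exists>P. orth_poly u n P"
    using ex_monic_orth_poly [OF lin qd] by blast
  note \<alpha> = pearsonD [OF assms(2)]
  have M: "invertible (M_mat \<alpha> \<Psi> (int k))" for k
    by (rule invertible_M_mat [OF lin ops assms(2)])
  define P where "P = monic_orth_poly u n"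
  define E where "E = E_mat u n"
  define V where "V = V_mat \<alpha> \<Psi> (int n - 1)"
  define \<kappa> where "\<kappa> = kappa u \<alpha> \<Psi> n"
  have P: "orth_poly u n P" "lead_coeff P = mat 1"
    unfolding P_def by (rule monic_orth_poly [OF lin qd])+
  have "invertible E"
    using P(1) by (simp add: E_def E_mat_def P_def orth_poly_def)
  have unique: "unique_up_to_right_factors (ode_solution \<alpha> \<Psi> n) y"
    if "orth_poly u n y" "ode_solution \<alpha> \<Psi> n y" for y
    using unique_ode_solution [OF \<alpha>(2,3) M _ that(2)] that(1) by (auto simp: orth_poly_def)
  have ode_0: "ode_solution \<alpha> \<Psi> n y" if "orth_poly u n y" "n = 0" for y
  proof -
    have "y = const_mp (coeff y 0)"
      using that by (metis degree_0_id monom_0 orth_poly_def)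
    then have "mp_deriv y = 0"
      by (metis mp_deriv_const)
    moreover have "mp_deriv 0 = (0 :: 'm mpoly)"
      by (rule poly_eqI) (simp add: coeff_mp_deriv)
    ultimately show ?thesis
      using that(2) by (simp add: ode_solution_def)
  qed
  have main: "invertible (E ** V) \<and> (\<exists>!Q. orth_poly u n Q \<and> lead_coeff Q = \<kappa>) \<and>
      (\<forall>Q. orth_poly u n Q \<and> lead_coeff Q = \<kappa> \<longrightarrow>
         unique_up_to_right_factors (ode_solution \<alpha> \<Psi> n) Q)"
    if n: "n \<ge> 1 \<or> invertible (M_mat \<alpha> \<Psi> (-1))"
  proof -
    have "invertible V"
      unfolding V_def
    proof (rule invertible_V_mat)
      fix i assume i: "int n - 1 \<le> i"
      show "invertible (M_mat \<alpha> \<Psi> i)"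
      proof (cases "i \<ge> 0")
        case True
        then show ?thesis using M [of "nat i"] by simp
      next
        \<comment> \<open>For \<open>n = 0\<close> the product \<open>V\<close> consists of the
          single factor M_(-1).\<close>
        case False
        with i have "i = -1" "n = 0" by auto
        with n show ?thesis by simp
      qed
    qed
    then have W: "invertible (E ** V)"
      by (rule invertible_mult [OF \<open>invertible E\<close>])
    have \<kappa>: "\<kappa> ** (E ** V) = mat 1" "(E ** V) ** \<kappa> = mat 1"
      using matrix_inv_mult [OF W] by (simp_all add: \<kappa>_def kappa_def E_def V_def)
    then have "invertible \<kappa>"
      by (auto simp: invertible_def)
    define Q where "Q = const_mp \<kappa> \<star> P"
    have Q: "orth_poly u n Q" "lead_coeff Q = \<kappa>"
      using orth_poly_const_star [OF lin P(1) \<open>invertible \<kappa>\<close>] P(2) by (simp_all add: Q_def)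
    have Q_unique: "R = Q" if "orth_poly u n R \<and> lead_coeff R = \<kappa>" for R
      using orth_poly_unique [OF lin qd, of n R Q] that Q by simp
    have "ode_solution \<alpha> \<Psi> n Q"
    proof (cases n)
      case 0
      with Q(1) ode_0 show ?thesis by blast
    next
      case (Suc m)
      \<comment> \<open>The choice of \<open>\<kappa>\<close> is the normalization with
        \<open>c = 1\<close>, as \<open>\<kappa> ** (E ** V) = mat 1\<close>.\<close>
      have "u (X_mp n \<star> Q) = \<kappa> ** E"
        unfolding Q_def E_def E_mat_def P_def X_mp_star_left_commute [symmetric]
        by (rule left_linear_const_star [OF lin])
      then have norm: "u (X_mp (Suc m) \<star> Q) ** V_mat \<alpha> \<Psi> (int m) = mat 1"
        using \<kappa>(1) by (simp add: V_def Suc matrix_mul_assoc)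
      show ?thesis
        unfolding Suc
        by (rule ode_solution_of_normalized [OF lin ops assms(2) _ _ norm])
          (use Q(1) in \<open>auto simp: orth_poly_def Suc\<close>)
    qed
    then have "unique_up_to_right_factors (ode_solution \<alpha> \<Psi> n) Q"
      by (rule unique [OF Q(1)])
    then show ?thesis
      using W Q Q_unique by metis
  qed
  moreover have "\<exists>y. unique_up_to_right_factors (ode_solution \<alpha> \<Psi> n) y \<and> orth_poly u n y"
  proof (cases "n = 0")
    case True
    then show ?thesis
      using unique [OF P(1)] ode_0 [OF P(1)] P(1) by blast
  next
    case False
    then show ?thesis
      using main by auto
  qed
  ultimately show ?thesis
    unfolding E_def V_def \<kappa>_def by blast
qed

end
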